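(* For any $n\geq 9$ and any integer $m$ with $0\leq m\leq \binom{n-5}{2}$ and $m\neq \binom{n-5}{2}-1$, there exists a neighborly piecewise linear (PL) simplicial $4$-sphere $\Delta$ with $n$ vertices and $m_3(\Delta)=m$.
   Context: A simplicial complex $\Delta$ on a finite vertex set $V$ is a non-empty collection of subsets (faces) of $V$ closed under inclusion and containing all singletons. A missing $i$-face is a subset of $V$ of size $i+1$ that is not a face but all of whose proper subsets are faces; $m_i(\Delta)$ is the number of missing $i$-faces. A PL $(d-1)$-sphere is a simplicial complex that is a piecewise linear triangulation of the $(d-1)$-sphere. A simplicial complex is $i$-neighborly if every $i$-subset of its vertices is a face; a simplicial $(d-1)$-sphere is neighborly if it is $\lfloor d/2\rfloor$-neighborly. In particular, a $4$-sphere is neighborly if and only if it is $2$-neighborly, i.e., every two vertices form an edge. *)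

theory Defs
  imports "HOL-Analysis.Analysis" "HOL-Analysis.Finite_Function_Topology"
begin

section \<open>Abstract simplicial complexes\<close>

definition abstract_complex :: "'v set \<Rightarrow> 'v set set \<Rightarrow> bool" where
  "abstract_complex V \<Delta> \<longleftrightarrow>
     finite V \<and> \<Delta> \<noteq> {} \<and> \<Delta> \<subseteq> Pow V \<and>
     (\<forall>\<sigma>\<in>\<Delta>. \<forall>\<tau>. \<tau> \<subseteq> \<sigma> \<longrightarrow> \<tau> \<in> \<Delta>) \<and>
     (\<forall>v\<in>V. {v} \<in> \<Delta>)"

definition missing_faces :: "nat \<Rightarrow> 'v set \<Rightarrow> 'v set set \<Rightarrow> 'v set set" where
  "missing_faces i V \<Delta> =
     {F. F \<subseteq> V \<and> card F = i + 1 \<and> F \<notin> \<Delta> \<and> (\<forall>G. G \<subset> F \<longrightarrow> G \<in> \<Delta>)}"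

definition num_missing_faces :: "nat \<Rightarrow> 'v set \<Rightarrow> 'v set set \<Rightarrow> nat" where
  "num_missing_faces i V \<Delta> = card (missing_faces i V \<Delta>)"

definition i_neighborly :: "nat \<Rightarrow> 'v set \<Rightarrow> 'v set set \<Rightarrow> bool" where
  "i_neighborly i V \<Delta> \<longleftrightarrow> (\<forall>F. F \<subseteq> V \<and> card F = i \<longrightarrow> F \<in> \<Delta>)"

text \<open>The parameter \<open>k\<close> is the dimension of the sphere: a \<open>(d - 1)\<close>-sphere is neighborly
  if it is \<open>\<lfloor>d/2\<rfloor>\<close>-neighborly, and here \<open>d = k + 1\<close>.\<close>

definition neighborly_sphere :: "nat \<Rightarrow> 'v set \<Rightarrow> 'v set set \<Rightarrow> bool" where
  "neighborly_sphere k V \<Delta> \<longleftrightarrow> i_neighborly ((k + 1) div 2) V \<Delta>"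


section \<open>Geometric realizations and PL spheres\<close>

text \<open>Vertex \<open>v\<close> is placed at the unit vector \<open>e\<^sub>v\<close> of the normed space of finitely
  supported functions, so that a complex with \<open>n\<close> vertices is realized as a subcomplex of the
  standard simplex in an \<open>n\<close>-dimensional coordinate subspace.\<close>

definition realization :: "'v set set \<Rightarrow> ('v \<Rightarrow>\<^sub>0 real) set" where
  "realization \<Delta> = (\<Union>\<sigma>\<in>\<Delta>. convex hull ((\<lambda>v. Poly_Mapping.single v 1) ` \<sigma>))"

definition affine_map_on :: "'a::real_vector set \<Rightarrow> ('a \<Rightarrow> 'b::real_vector) \<Rightarrow> bool" where
  "affine_map_on C f \<longleftrightarrow>
     (\<forall>x\<in>C. \<forall>y\<in>C. \<forall>t\<in>{0..1}.
        f ((1 - t) *\<^sub>R x + t *\<^sub>R y) = (1 - t) *\<^sub>R f x + t *\<^sub>R f y)"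

text \<open>The polytopes of the cover need not form a complex: any finite cover by polytopes can be
  refined to a triangulation, so this agrees with being affine on each simplex of some finite
  simplicial subdivision.\<close>

definition piecewise_linear_on ::
    "'a::real_normed_vector set \<Rightarrow> ('a \<Rightarrow> 'b::real_normed_vector) \<Rightarrow> bool" where
  "piecewise_linear_on S f \<longleftrightarrow>
     continuous_on S f \<and>
     (\<exists>\<P>. finite \<P> \<and> \<Union>\<P> = S \<and> (\<forall>C\<in>\<P>. polytope C \<and> affine_map_on C f))"

definition pl_homeomorphic ::
    "'a::real_normed_vector set \<Rightarrow> 'b::real_normed_vector set \<Rightarrow> bool" where
  "pl_homeomorphic S T \<longleftrightarrow>
     (\<exists>f g. homeomorphism S T f g \<and> piecewise_linear_on S f \<and> piecewise_linear_on T g)"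

text \<open>The standard PL \<open>k\<close>-sphere is the boundary of the \<open>(k + 1)\<close>-simplex, whose faces are the
  proper subsets of a set of \<open>k + 2\<close> vertices.\<close>

definition simplex_boundary :: "nat \<Rightarrow> nat set set" where
  "simplex_boundary k = {\<sigma>. \<sigma> \<subset> {..k + 1}}"

definition pl_sphere :: "nat \<Rightarrow> 'v set \<Rightarrow> 'v set set \<Rightarrow> bool" where
  "pl_sphere k V \<Delta> \<longleftrightarrow>
     abstract_complex V \<Delta> \<and>
     pl_homeomorphic (realization \<Delta>) (realization (simplex_boundary k))"

end

theory Submission
  imports Defs
begin

text \<open>Let \<open>e = {u, t}\<close> be an edge of a 2-neighborly 4-sphere whose link \<open>L\<close>, a 2-sphere, contains
  all other vertices. Take a triangle of \<open>L\<close>, or two triangles of \<open>L\<close> sharing an edge whose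
  opposite vertices are not adjacent in \<open>L\<close>, and let \<open>Q\<close> be the closure of the rest of \<open>L\<close>.
  Replacing the ball \<open>e * Q\<close> by the cone with a new apex \<open>v\<close> over its boundary gives a 2-neighborly
  4-sphere with one more vertex, in which \<open>{u, v}\<close> has the properties of \<open>e\<close>; its link is \<open>L\<close> with
  one triangle, respectively one edge, subdivided by \<open>t\<close>. If no missing 3-face contains \<open>e\<close>, the
  move increases the number of missing 3-faces by the number of separating triangles of the
  new link, and no missing 3-face contains \<open>{u, v}\<close>.

  Subdividing a triangle adds one separating triangle; subdividing an edge destroys
  those through that edge. Starting from the boundary of the 5-simplex, \<open>a\<close> subdivisions of
  triangles produce \<open>1 + 2 + \<dots> + a\<close> missing 3-faces. Distributing them over two disjoint
  edges of \<open>L\<close> allows to reduce the number of separating triangles to any \<open>r < a\<close> and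
  then to \<open>0\<close>, for a total of \<open>1 + \<dots> + a + r\<close>; an excess of \<open>r = a\<close> is spread over two moves. This
  makes all \<open>m > 0\<close> in the range reachable, while \<open>m = 0\<close> needs a special sphere with 9 vertices.

  Each move is a stellar subdivision of \<open>e\<close> followed by one or two bistellar flips, and a flip
  is a stellar subdivision followed by an inverse one.\<close>

section \<open>Piecewise linear maps\<close>

text \<open>The graph of an affine map over a convex set is convex, so it contains all convex
  combinations of its points. No induction on \<open>I\<close> is required.\<close>

lemma affine_map_on_sum:
  fixes f :: "'a::real_vector \<Rightarrow> 'b::real_vector"
  assumes "affine_map_on C f" "convex C" "finite I"
    and "(\<Sum>i\<in>I. a i) = 1" "\<And>i. i \<in> I \<Longrightarrow> a i \<ge> 0" "\<And>i. i \<in> I \<Longrightarrow> y i \<in> C"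
  shows "f (\<Sum>i\<in>I. a i *\<^sub>R y i) = (\<Sum>i\<in>I. a i *\<^sub>R f (y i))"
proof -
  let ?G = "(\<lambda>x. (x, f x)) ` C"
  have "convex ?G"
    unfolding convex_alt
  proof clarify
    fix x y :: 'a and t :: real
    assume *: "x \<in> C" "y \<in> C" "0 \<le> t" "t \<le> 1"
    then have "(1 - t) *\<^sub>R x + t *\<^sub>R y \<in> C"
      using \<open>convex C\<close> by (simp add: convex_alt)
    moreover have "f ((1 - t) *\<^sub>R x + t *\<^sub>R y) = (1 - t) *\<^sub>R f x + t *\<^sub>R f y"
      using assms(1) * unfolding affine_map_on_def by auto
    ultimately show "(1 - t) *\<^sub>R (x, f x) + t *\<^sub>R (y, f y) \<in> ?G"
      by (auto simp: image_iff)
  qed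
  then have "(\<Sum>i\<in>I. a i *\<^sub>R (y i, f (y i))) \<in> ?G"
    using assms(3-6) by (intro convex_sum) auto
  moreover have "(\<Sum>i\<in>I. a i *\<^sub>R (y i, f (y i))) = (\<Sum>i\<in>I. a i *\<^sub>R y i, \<Sum>i\<in>I. a i *\<^sub>R f (y i))"
    by (simp add: prod_eq_iff fst_sum snd_sum)
  ultimately show ?thesis
    by auto
qed

lemma affine_map_on_mono: "affine_map_on C f \<Longrightarrow> D \<subseteq> C \<Longrightarrow> affine_map_on D f"
  unfolding affine_map_on_def by blast

lemma affine_map_on_linear: "linear f \<Longrightarrow> affine_map_on C f"
  unfolding affine_map_on_def by (simp add: linear_add linear_scale)

lemma convex_hull_affine_image_subset:
  assumes "affine_map_on (convex hull S) f"
  shows "f ` (convex hull S) \<subseteq> convex hull (f ` S)"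
proof -
  let ?X = "{x \<in> convex hull S. f x \<in> convex hull (f ` S)}"
  have "convex ?X"
  proof (rule iffD2[OF convex_alt], intro ballI allI impI)
    fix x y and t :: real
    assume "x \<in> ?X" "y \<in> ?X" "0 \<le> t \<and> t \<le> 1"
    then have *: "x \<in> convex hull S" "y \<in> convex hull S" "0 \<le> t" "t \<le> 1"
      "f x \<in> convex hull (f ` S)" "f y \<in> convex hull (f ` S)"
      by auto
    have "(1 - t) *\<^sub>R x + t *\<^sub>R y \<in> convex hull S"
      using convex_convex_hull[of S] by (simp add: convex_alt * del: convex_convex_hull)
    moreover have "f ((1 - t) *\<^sub>R x + t *\<^sub>R y) = (1 - t) *\<^sub>R f x + t *\<^sub>R f y"
      using assms * unfolding affine_map_on_def by auto
    moreover have "(1 - t) *\<^sub>R f x + t *\<^sub>R f y \<in> convex hull (f ` S)"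
      using convex_convex_hull[of "f ` S"] * by (simp add: convex_alt del: convex_convex_hull)
    ultimately show "(1 - t) *\<^sub>R x + t *\<^sub>R y \<in> ?X"
      by simp
  qed
  moreover have "S \<subseteq> ?X"
    by (auto intro: hull_inc)
  ultimately have "convex hull S \<subseteq> ?X"
    by (intro hull_minimal)
  then show ?thesis by blast
qed

section \<open>Slices and affine preimages of polytopes\<close>

text \<open>The slice is spanned by the generators on the hyperplane and by the crossing points of
  the segments that join a generator on the negative side to one on the positive side.\<close>

lemma polytope_hyperplane_slice:
  fixes h :: "'a::real_vector \<Rightarrow> real"
  assumes "polytope C" "affine_map_on C h"
  shows "polytope {x \<in> C. h x = 0}"
proof -
  obtain S where S: "finite S" "C = convex hull S"
    using assms(1) unfolding polytope_def by blast
  have "convex C" "S \<subseteq> C"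
    using S by (auto simp: hull_subset)
  define N where "N = {s \<in> S. h s < 0}"
  define Z where "Z = {s \<in> S. h s = 0}"
  define P where "P = {s \<in> S. h s > 0}"
  \<comment> \<open>\<open>cr (s, s')\<close> is the point where the segment from \<open>s\<close>
    to \<open>s'\<close> meets the hyperplane \<open>h = 0\<close>.\<close>
  define cr where "cr = (\<lambda>(s, s'). (h s' / (h s' - h s)) *\<^sub>R s + (- h s / (h s' - h s)) *\<^sub>R s')"
  have fin: "finite N" "finite Z" "finite P"
    using S(1) by (auto simp: N_def Z_def P_def)
  have split: "sum g S = sum g Z + (sum g N + sum g P)" for g :: "'a \<Rightarrow> 'c::comm_monoid_add"
  proof -
    have "S = Z \<union> (N \<union> P)" "Z \<inter> (N \<union> P) = {}" "N \<inter> P = {}"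
      by (auto simp: N_def Z_def P_def)
    then show ?thesis
      using fin by (simp add: sum.union_disjoint)
  qed
  define K where "K = convex hull (Z \<union> cr ` (N \<times> P))"
  have "{x \<in> C. h x = 0} = K"
  proof
    have conv: "convex {x \<in> C. h x = 0}"
      unfolding convex_alt
    proof clarify
      fix x y and t :: real
      assume *: "x \<in> C" "y \<in> C" "0 \<le> t" "t \<le> 1" "h x = 0" "h y = 0"
      then have "(1 - t) *\<^sub>R x + t *\<^sub>R y \<in> C"
        using \<open>convex C\<close> by (simp add: convex_alt)
      moreover have "h ((1 - t) *\<^sub>R x + t *\<^sub>R y) = (1 - t) *\<^sub>R h x + t *\<^sub>R h y"
        using assms(2) *(1-4) unfolding affine_map_on_def by auto
      ultimately show "(1 - t) *\<^sub>R x + t *\<^sub>R y \<in> C \<and> h ((1 - t) *\<^sub>R x + t *\<^sub>R y) = 0"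
        using * by simp
    qed
    have "cr (s, s') \<in> {x \<in> C. h x = 0}" if "s \<in> N" "s' \<in> P" for s s'
    proof -
      define t where "t = - h s / (h s' - h s)"
      have pos: "h s' - h s > 0" "h s < 0" "h s' > 0" and C: "s \<in> C" "s' \<in> C"
        using that \<open>S \<subseteq> C\<close> by (auto simp: N_def P_def)
      have t: "t \<in> {0..1}" "h s' / (h s' - h s) = 1 - t"
        using pos by (auto simp: t_def field_simps)
      have eq: "cr (s, s') = (1 - t) *\<^sub>R s + t *\<^sub>R s'"
        unfolding cr_def prod.case t(2) t_def ..
      have "h ((1 - t) *\<^sub>R s + t *\<^sub>R s') = (1 - t) *\<^sub>R h s + t *\<^sub>R h s'"
        using assms(2) C t(1) unfolding affine_map_on_def by blast
      also have "\<dots> = h s' / (h s' - h s) * h s + - h s / (h s' - h s) * h s'"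
        by (simp only: t(2)[symmetric] real_scaleR_def) (simp add: t_def)
      also have "\<dots> = 0"
        by (simp add: field_simps)
      finally show ?thesis
        using \<open>convex C\<close> C t(1) by (simp add: eq convex_alt)
    qed
    moreover have "Z \<subseteq> {x \<in> C. h x = 0}"
      using \<open>S \<subseteq> C\<close> by (auto simp: Z_def)
    ultimately show "K \<subseteq> {x \<in> C. h x = 0}"
      unfolding K_def using conv by (intro hull_minimal) auto
  next
    show "{x \<in> C. h x = 0} \<subseteq> K"
    proof clarify
      fix x assume "x \<in> C" and hx: "h x = 0"
      then obtain u where u: "\<And>s. s \<in> S \<Longrightarrow> 0 \<le> u s" "sum u S = 1" "(\<Sum>s\<in>S. u s *\<^sub>R s) = x"
        unfolding S(2) convex_hull_finite[OF S(1)] by blast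
      have "h x = (\<Sum>s\<in>S. u s *\<^sub>R h s)"
        unfolding u(3)[symmetric] using \<open>S \<subseteq> C\<close> u
        by (intro affine_map_on_sum[OF assms(2) \<open>convex C\<close> S(1)]) auto
      then have sum0: "(\<Sum>s\<in>N. u s * h s) + (\<Sum>s\<in>P. u s * h s) = 0"
        using hx split[of "\<lambda>s. u s * h s"] by (simp add: Z_def)
      \<comment> \<open>On the slice the weighted sum of \<open>h\<close> vanishes, so the positive
        and the negative contributions have the same size \<open>A\<close>. If it is 0, all the
        weight lies on \<open>Z\<close>.\<close>
      define A where "A = (\<Sum>s\<in>P. u s * h s)"
      have AN: "(\<Sum>s\<in>N. u s * (- h s)) = A"
        using sum0 by (simp add: A_def sum_negf)
      have convK: "convex K" and ZK: "Z \<subseteq> K" and crK: "cr ` (N \<times> P) \<subseteq> K"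
        by (auto simp: K_def hull_inc)
      show "x \<in> K"
      proof (cases "A = 0")
        case True
        have "\<forall>s\<in>P. u s * h s = 0"
          using True fin u(1) unfolding A_def
          by (subst (asm) sum_nonneg_eq_0_iff) (auto simp: P_def)
        moreover have "\<forall>s\<in>N. u s * (- h s) = 0"
          using True fin u(1) AN
          by (subst (asm) AN[symmetric], subst (asm) sum_nonneg_eq_0_iff)
             (auto simp: N_def mult_nonneg_nonpos)
        ultimately have z: "\<forall>s\<in>P. u s = 0" "\<forall>s\<in>N. u s = 0"
          by (auto simp: P_def N_def)
        have "sum u Z = 1" "(\<Sum>s\<in>Z. u s *\<^sub>R s) = x"
          using u(2,3) z by (simp_all add: split)
        then show ?thesis
          using convex_sum[OF fin(2) convK, of u "\<lambda>s. s"] u(1) ZK by (auto simp: Z_def)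
      next
        case False
        have "A \<ge> 0"
          unfolding A_def using u(1) by (intro sum_nonneg) (auto simp: P_def)
        with False have "A > 0" by simp
        \<comment> \<open>This is a transport of the negative mass to the positive mass in product
          form. Its two marginals, computed in \<open>swapsum\<close>, are the given weights on
          \<open>N\<close> and on \<open>P\<close>, so the crossing points with weights
          \<open>w\<close> replace these two groups of generators.\<close>
        define w where "w = (\<lambda>(s, s'). u s * u s' * (h s' - h s) / A)"
        have swapsum: "(\<Sum>s\<in>N. \<Sum>s'\<in>P. (u s * u s' * h s' / A) *\<^sub>R g s) = (\<Sum>s\<in>N. u s *\<^sub>R g s)"
          "(\<Sum>s\<in>N. \<Sum>s'\<in>P. (u s * u s' * (- h s) / A) *\<^sub>R g s') = (\<Sum>s'\<in>P. u s' *\<^sub>R g s')"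
          for g :: "'a \<Rightarrow> 'c::real_vector"
        proof -
          have "(\<Sum>s'\<in>P. u s * u s' * h s' / A) = u s * A / A" for s
            by (simp add: A_def sum_distrib_left sum_divide_distrib mult.assoc)
          then show "(\<Sum>s\<in>N. \<Sum>s'\<in>P. (u s * u s' * h s' / A) *\<^sub>R g s) = (\<Sum>s\<in>N. u s *\<^sub>R g s)"
            using False by (simp add: scaleR_sum_left[symmetric])
          have "(\<Sum>s\<in>N. u s * u s' * (- h s) / A) = u s' * A / A" for s'
            unfolding AN[symmetric] by (simp add: sum_distrib_left sum_divide_distrib mult_ac)
          moreover have "(\<Sum>s\<in>N. \<Sum>s'\<in>P. (u s * u s' * (- h s) / A) *\<^sub>R g s')
              = (\<Sum>s'\<in>P. (\<Sum>s\<in>N. u s * u s' * (- h s) / A) *\<^sub>R g s')"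
            by (subst sum.swap) (simp only: scaleR_sum_left)
          ultimately show "(\<Sum>s\<in>N. \<Sum>s'\<in>P. (u s * u s' * (- h s) / A) *\<^sub>R g s') = (\<Sum>s'\<in>P. u s' *\<^sub>R g s')"
            using False by (simp only: nonzero_mult_div_cancel_right not_False_eq_True)
        qed
        have "(\<Sum>p\<in>N \<times> P. w p) = (\<Sum>s\<in>N. \<Sum>s'\<in>P. (u s * u s' * h s' / A) *\<^sub>R 1)
            + (\<Sum>s\<in>N. \<Sum>s'\<in>P. (u s * u s' * (- h s) / A) *\<^sub>R 1)"
          unfolding sum.cartesian_product' sum.distrib[symmetric]
          by (intro sum.cong refl) (auto simp: w_def field_simps diff_divide_distrib)
        then have w1: "sum u Z + (\<Sum>p\<in>N \<times> P. w p) = 1"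
          using u(2) unfolding swapsum by (simp add: split)
        have "w (s, s') *\<^sub>R cr (s, s') = (u s * u s' * h s' / A) *\<^sub>R s + (u s * u s' * (- h s) / A) *\<^sub>R s'"
          if "s \<in> N" "s' \<in> P" for s s'
        proof -
          have "h s' - h s \<noteq> 0"
            using that by (auto simp: N_def P_def)
          then have "u s * u s' * (h s' - h s) / A * (c / (h s' - h s)) = u s * u s' * c / A" for c
            by simp
          then show ?thesis
            by (simp only: w_def cr_def prod.case scaleR_add_right scaleR_scaleR)
        qed
        then have "(\<Sum>p\<in>N \<times> P. w p *\<^sub>R cr p) = (\<Sum>s\<in>N. \<Sum>s'\<in>P. (u s * u s' * h s' / A) *\<^sub>R s)
            + (\<Sum>s\<in>N. \<Sum>s'\<in>P. (u s * u s' * (- h s) / A) *\<^sub>R s')"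
          unfolding sum.cartesian_product' sum.distrib[symmetric]
          by (intro sum.cong refl) auto
        then have w2: "(\<Sum>s\<in>Z. u s *\<^sub>R s) + (\<Sum>p\<in>N \<times> P. w p *\<^sub>R cr p) = x"
          using u(3) unfolding swapsum by (simp add: split)
        have wpos: "w p \<ge> 0" if "p \<in> N \<times> P" for p
          using that \<open>A > 0\<close> u(1) by (auto simp: w_def N_def P_def intro!: divide_nonneg_pos mult_nonneg_nonneg)
        have "(\<Sum>i\<in>Z <+> N \<times> P. case_sum u w i *\<^sub>R case_sum (\<lambda>s. s) cr i) \<in> K"
          using fin w1 wpos u(1) ZK crK
          by (intro convex_sum convK) (auto simp: sum.Plus Z_def)
        then show ?thesis
          using fin w2 by (simp add: sum.Plus)
      qed
    qed
  qed
  then show ?thesis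
    unfolding K_def using fin by (auto intro: polytope_convex_hull)
qed

lemma lookup_scaleR: "Poly_Mapping.lookup (r *\<^sub>R x) k = r *\<^sub>R Poly_Mapping.lookup x k"
  by (simp add: scaleR_poly_mapping_def)

text \<open>The preimage is the projection of the slice \<open>f x = y\<close> of the polytope \<open>C \<times> D\<close>; as
  all points involved have their support in a fixed finite set, finitely many hyperplanes
  suffice.\<close>

lemma polytope_affine_preimage:
  fixes f :: "'a::real_vector \<Rightarrow> ('b \<Rightarrow>\<^sub>0 real)"
  assumes "polytope C" "polytope D" "affine_map_on C f"
  shows "polytope {x \<in> C. f x \<in> D}"
proof -
  obtain S where S: "finite S" "C = convex hull S"
    using assms(1) unfolding polytope_def by blast
  obtain T where T: "finite T" "D = convex hull T"
    using assms(2) unfolding polytope_def by blast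
  define K where "K = (\<Union>y\<in>f ` S \<union> T. Poly_Mapping.keys y)"
  have finK: "finite K"
    using S(1) T(1) by (auto simp: K_def)
  have "convex {y :: 'b \<Rightarrow>\<^sub>0 real. Poly_Mapping.keys y \<subseteq> K}"
    unfolding convex_alt
  proof clarify
    fix x y :: "'b \<Rightarrow>\<^sub>0 real" and t :: real and k
    assume *: "Poly_Mapping.keys x \<subseteq> K" "Poly_Mapping.keys y \<subseteq> K"
      "k \<in> Poly_Mapping.keys ((1 - t) *\<^sub>R x + t *\<^sub>R y)"
    then have "Poly_Mapping.lookup x k \<noteq> 0 \<or> Poly_Mapping.lookup y k \<noteq> 0"
      by (auto simp: in_keys_iff lookup_add lookup_scaleR)
    then show "k \<in> K"
      using * by (auto simp: in_keys_iff subset_iff)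
  qed
  then have keysK: "convex hull (f ` S \<union> T) \<subseteq> {y. Poly_Mapping.keys y \<subseteq> K}"
    by (intro hull_minimal) (auto simp: K_def)
  have "f ` C \<subseteq> convex hull (f ` S)"
    unfolding S(2) using assms(3) S(2) by (intro convex_hull_affine_image_subset) simp
  also have "\<dots> \<subseteq> convex hull (f ` S \<union> T)"
    by (intro hull_mono) simp
  finally have fK: "Poly_Mapping.keys (f x) \<subseteq> K" if "x \<in> C" for x
    using that keysK by blast
  have "D \<subseteq> convex hull (f ` S \<union> T)"
    unfolding T(2) by (intro hull_mono) simp
  then have DK: "Poly_Mapping.keys y \<subseteq> K" if "y \<in> D" for y
    using that keysK by blast
  define h where "h = (\<lambda>k p. Poly_Mapping.lookup (f (fst p)) k - Poly_Mapping.lookup (snd p) k)"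
  have aff: "affine_map_on (C \<times> D) (h k)" for k
    unfolding affine_map_on_def
  proof (intro ballI)
    fix p q and t :: real assume *: "p \<in> C \<times> D" "q \<in> C \<times> D" "t \<in> {0..1}"
    then have "f ((1 - t) *\<^sub>R fst p + t *\<^sub>R fst q) = (1 - t) *\<^sub>R f (fst p) + t *\<^sub>R f (fst q)"
      using assms(3) unfolding affine_map_on_def by auto
    then show "h k ((1 - t) *\<^sub>R p + t *\<^sub>R q) = (1 - t) *\<^sub>R h k p + t *\<^sub>R h k q"
      by (simp add: h_def lookup_add lookup_scaleR right_diff_distrib)
  qed
  \<comment> \<open>The slice \<open>f x = y\<close> is cut out one coordinate at a time.
    Coordinates outside \<open>K\<close> vanish on both sides and impose nothing.\<close>
  have "polytope {p \<in> C \<times> D. \<forall>k\<in>L. h k p = 0}" if "finite L" for L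
    using that
  proof (induction L)
    case empty
    then show ?case
      using polytope_Times[OF assms(1,2)] by simp
  next
    case (insert k L)
    have "{p \<in> C \<times> D. \<forall>k\<in>insert k L. h k p = 0} = {p \<in> {p \<in> C \<times> D. \<forall>k\<in>L. h k p = 0}. h k p = 0}"
      by auto
    also have "polytope \<dots>"
      by (rule polytope_hyperplane_slice[OF insert.IH]) (rule affine_map_on_mono[OF aff], auto)
    finally show ?case .
  qed
  from this[OF finK] have "polytope (fst ` {p \<in> C \<times> D. \<forall>k\<in>K. h k p = 0})"
    by (intro polytope_linear_image linear_fst)
  also have "fst ` {p \<in> C \<times> D. \<forall>k\<in>K. h k p = 0} = {x \<in> C. f x \<in> D}"
  proof -
    have "(\<forall>k\<in>K. h k (x, y) = 0) \<longleftrightarrow> f x = y" if "x \<in> C" "y \<in> D" for x y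
    proof
      assume *: "\<forall>k\<in>K. h k (x, y) = 0"
      show "f x = y"
      proof (rule poly_mapping_eqI)
        fix k
        show "Poly_Mapping.lookup (f x) k = Poly_Mapping.lookup y k"
        proof (cases "k \<in> K")
          case True
          then show ?thesis using * by (auto simp: h_def)
        next
          case False
          then have "k \<notin> Poly_Mapping.keys (f x)" "k \<notin> Poly_Mapping.keys y"
            using fK DK that by blast+
          then show ?thesis by (simp add: in_keys_iff)
        qed
      qed
    qed (simp add: h_def)
    then show ?thesis
      by (force simp: image_iff)
  qed
  finally show ?thesis .
qed

section \<open>Composition of PL maps\<close>

text \<open>The pieces are those of \<open>f\<close> intersected with the preimages of those of
  \<open>g\<close>. The middle space consists of finitely supported functions so that
  \<open>polytope_affine_preimage\<close> makes these sets polytopes.\<close>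

lemma piecewise_linear_on_compose:
  fixes f :: "'a::real_normed_vector \<Rightarrow> ('b \<Rightarrow>\<^sub>0 real)" and g :: "('b \<Rightarrow>\<^sub>0 real) \<Rightarrow> 'c::real_normed_vector"
  assumes f: "piecewise_linear_on S f" and g: "piecewise_linear_on T g" and "f ` S \<subseteq> T"
  shows "piecewise_linear_on S (g \<circ> f)"
proof -
  obtain \<P> where P: "finite \<P>" "\<Union>\<P> = S" "\<And>C. C \<in> \<P> \<Longrightarrow> polytope C \<and> affine_map_on C f"
    using f unfolding piecewise_linear_on_def by blast
  obtain \<Q> where Q: "finite \<Q>" "\<Union>\<Q> = T" "\<And>C. C \<in> \<Q> \<Longrightarrow> polytope C \<and> affine_map_on C g"
    using g unfolding piecewise_linear_on_def by blast
  let ?R = "(\<lambda>(C, D). {x \<in> C. f x \<in> D}) ` (\<P> \<times> \<Q>)"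
  have "continuous_on S (g \<circ> f)"
    using assms unfolding piecewise_linear_on_def by (meson continuous_on_compose continuous_on_subset)
  moreover have "finite ?R"
    using P(1) Q(1) by simp
  moreover have "\<Union>?R = S"
    using P(2) Q(2) \<open>f ` S \<subseteq> T\<close> by fastforce
  moreover have "polytope {x \<in> C. f x \<in> D} \<and> affine_map_on {x \<in> C. f x \<in> D} (g \<circ> f)"
    if "C \<in> \<P>" "D \<in> \<Q>" for C D
  proof
    show "polytope {x \<in> C. f x \<in> D}"
      using that P(3) Q(3) by (intro polytope_affine_preimage) auto
    have "affine_map_on C f" "affine_map_on D g"
      using that P(3) Q(3) by auto
    then show "affine_map_on {x \<in> C. f x \<in> D} (g \<circ> f)"
      unfolding affine_map_on_def by simp
  qed
  ultimately show ?thesis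
    unfolding piecewise_linear_on_def by (intro conjI exI[of _ ?R]) auto
qed

lemma pl_homeomorphic_sym: "pl_homeomorphic S T \<Longrightarrow> pl_homeomorphic T S"
  unfolding pl_homeomorphic_def using homeomorphism_sym by blast

lemma pl_homeomorphic_trans:
  fixes S :: "('a \<Rightarrow>\<^sub>0 real) set" and T :: "('b \<Rightarrow>\<^sub>0 real) set" and U :: "('c \<Rightarrow>\<^sub>0 real) set"
  assumes "pl_homeomorphic S T" "pl_homeomorphic T U"
  shows "pl_homeomorphic S U"
proof -
  obtain f f' where f: "homeomorphism S T f f'" "piecewise_linear_on S f" "piecewise_linear_on T f'"
    using assms(1) unfolding pl_homeomorphic_def by blast
  obtain g g' where g: "homeomorphism T U g g'" "piecewise_linear_on T g" "piecewise_linear_on U g'"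
    using assms(2) unfolding pl_homeomorphic_def by blast
  have "homeomorphism S U (g \<circ> f) (f' \<circ> g')"
    using f(1) g(1) by (rule homeomorphism_compose)
  moreover have "piecewise_linear_on S (g \<circ> f)"
    using f g by (intro piecewise_linear_on_compose) (auto simp: homeomorphism_def)
  moreover have "piecewise_linear_on U (f' \<circ> g')"
    using f g by (intro piecewise_linear_on_compose) (auto simp: homeomorphism_def)
  ultimately show ?thesis
    unfolding pl_homeomorphic_def by blast
qed

section \<open>Stellar subdivisions and bistellar flips\<close>

lemma abstract_complexD:
  assumes "abstract_complex V \<Delta>"
  shows "finite V" "\<sigma> \<in> \<Delta> \<Longrightarrow> \<sigma> \<subseteq> V" "\<sigma> \<in> \<Delta> \<Longrightarrow> finite \<sigma>"
    "\<sigma> \<in> \<Delta> \<Longrightarrow> \<tau> \<subseteq> \<sigma> \<Longrightarrow> \<tau> \<in> \<Delta>" "v \<in> V \<Longrightarrow> {v} \<in> \<Delta>" "{} \<in> \<Delta>" "finite \<Delta>"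
proof -
  show V: "finite V" and sub: "\<sigma> \<in> \<Delta> \<Longrightarrow> \<sigma> \<subseteq> V" for \<sigma>
    using assms by (auto simp: abstract_complex_def)
  show "\<sigma> \<in> \<Delta> \<Longrightarrow> finite \<sigma>"
    using V sub finite_subset by blast
  show down: "\<sigma> \<in> \<Delta> \<Longrightarrow> \<tau> \<subseteq> \<sigma> \<Longrightarrow> \<tau> \<in> \<Delta>" for \<sigma> \<tau>
    using assms unfolding abstract_complex_def by blast
  show "v \<in> V \<Longrightarrow> {v} \<in> \<Delta>"
    using assms by (simp add: abstract_complex_def)
  show "{} \<in> \<Delta>"
    using assms down unfolding abstract_complex_def by (metis all_not_in_conv empty_subsetI)
  show "finite \<Delta>"
    using V assms unfolding abstract_complex_def by (meson finite_Pow_iff finite_subset)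
qed

section \<open>Realizations in barycentric coordinates\<close>

lemma in_convex_hull_unit_vectors:
  assumes "finite \<sigma>"
  shows "x \<in> convex hull ((\<lambda>v. Poly_Mapping.single v (1::real)) ` \<sigma>) \<longleftrightarrow>
    (\<forall>k. 0 \<le> Poly_Mapping.lookup x k) \<and> Poly_Mapping.keys x \<subseteq> \<sigma> \<and> sum (Poly_Mapping.lookup x) \<sigma> = 1"
    (is "_ \<longleftrightarrow> ?P x")
proof
  have "convex (Collect ?P)"
  proof (rule iffD2[OF convex_alt], intro ballI allI impI)
    fix x y and t :: real
    assume *: "x \<in> Collect ?P" "y \<in> Collect ?P" "0 \<le> t \<and> t \<le> 1"
    have "sum (Poly_Mapping.lookup ((1 - t) *\<^sub>R x + t *\<^sub>R y)) \<sigma>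
        = (1 - t) * sum (Poly_Mapping.lookup x) \<sigma> + t * sum (Poly_Mapping.lookup y) \<sigma>"
      by (simp add: lookup_add lookup_scaleR sum.distrib sum_distrib_left)
    moreover have "Poly_Mapping.keys ((1 - t) *\<^sub>R x + t *\<^sub>R y) \<subseteq> \<sigma>"
    proof
      fix k assume "k \<in> Poly_Mapping.keys ((1 - t) *\<^sub>R x + t *\<^sub>R y)"
      then have "k \<in> Poly_Mapping.keys x \<or> k \<in> Poly_Mapping.keys y"
        by (auto simp: in_keys_iff lookup_add lookup_scaleR)
      then show "k \<in> \<sigma>"
        using * by auto
    qed
    ultimately show "(1 - t) *\<^sub>R x + t *\<^sub>R y \<in> Collect ?P"
      using * by (simp add: lookup_add lookup_scaleR)
  qed
  moreover have "(\<lambda>v. Poly_Mapping.single v (1::real)) ` \<sigma> \<subseteq> Collect ?P"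
    using assms by (auto simp: lookup_single when_def sum.delta)
  ultimately have "convex hull ((\<lambda>v. Poly_Mapping.single v (1::real)) ` \<sigma>) \<subseteq> Collect ?P"
    by (intro hull_minimal)
  then show "x \<in> convex hull ((\<lambda>v. Poly_Mapping.single v (1::real)) ` \<sigma>) \<Longrightarrow> ?P x"
    by blast
next
  assume P: "?P x"
  have "x = (\<Sum>k\<in>\<sigma>. Poly_Mapping.lookup x k *\<^sub>R Poly_Mapping.single k 1)"
  proof (rule poly_mapping_eqI)
    fix k
    show "Poly_Mapping.lookup x k
        = Poly_Mapping.lookup (\<Sum>k\<in>\<sigma>. Poly_Mapping.lookup x k *\<^sub>R Poly_Mapping.single k 1) k"
      using P assms
      by (cases "k \<in> \<sigma>") (auto simp: lookup_sum lookup_scaleR lookup_single when_def in_keys_iff if_distrib[of "\<lambda>x. _ * x"] sum.delta cong: if_cong)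
  qed
  also have "\<dots> \<in> convex hull ((\<lambda>v. Poly_Mapping.single v (1::real)) ` \<sigma>)"
    using P assms by (intro convex_sum) (auto intro: hull_inc)
  finally show "x \<in> convex hull ((\<lambda>v. Poly_Mapping.single v (1::real)) ` \<sigma>)" .
qed

text \<open>The coordinates are summed over a fixed set \<open>M\<close> and not over a face, so
  that complexes with different vertex sets can be compared under the same normalization.\<close>

lemma in_realization:
  assumes "abstract_complex V \<Delta>" "finite M" "V \<subseteq> M"
  shows "x \<in> realization \<Delta> \<longleftrightarrow> (\<forall>k. 0 \<le> Poly_Mapping.lookup x k) \<and> Poly_Mapping.keys x \<in> \<Delta>
    \<and> sum (Poly_Mapping.lookup x) M = 1"
proof -
  have eq: "sum (Poly_Mapping.lookup x) \<sigma> = sum (Poly_Mapping.lookup x) M"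
    if "\<sigma> \<in> \<Delta>" "Poly_Mapping.keys x \<subseteq> \<sigma>" for \<sigma>
    using that assms abstract_complexD(2)[OF assms(1) that(1)]
    by (intro sum.mono_neutral_left) (auto simp: in_keys_iff)
  have "x \<in> realization \<Delta> \<longleftrightarrow> (\<exists>\<sigma>\<in>\<Delta>. (\<forall>k. 0 \<le> Poly_Mapping.lookup x k) \<and> Poly_Mapping.keys x \<subseteq> \<sigma>
      \<and> sum (Poly_Mapping.lookup x) \<sigma> = 1)"
    unfolding realization_def using abstract_complexD(3)[OF assms(1)]
    by (simp add: in_convex_hull_unit_vectors)
  also have "\<dots> \<longleftrightarrow> (\<forall>k. 0 \<le> Poly_Mapping.lookup x k) \<and> Poly_Mapping.keys x \<in> \<Delta>
      \<and> sum (Poly_Mapping.lookup x) M = 1"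
    using eq abstract_complexD(4)[OF assms(1)] by (metis subset_refl)
  finally show ?thesis .
qed

section \<open>Stellar subdivision\<close>

text \<open>The sets that receive \<open>w\<close> form the join of the boundary of \<open>F\<close>
  with the link of \<open>F\<close>, so the star of \<open>F\<close> is replaced by the cone over
  this join.\<close>

definition stellar :: "'v set \<Rightarrow> 'v \<Rightarrow> 'v set set \<Rightarrow> 'v set set" where
  "stellar F w \<Delta> = {\<sigma> \<in> \<Delta>. \<not> F \<subseteq> \<sigma>} \<union> insert w ` {\<sigma> \<in> \<Delta>. \<not> F \<subseteq> \<sigma> \<and> \<sigma> \<union> F \<in> \<Delta>}"

lemma in_stellar:
  assumes "abstract_complex V \<Delta>" "w \<notin> V"
  shows "\<sigma> \<in> stellar F w \<Delta> \<longleftrightarrow>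
    (if w \<in> \<sigma> then \<not> F \<subseteq> \<sigma> - {w} \<and> \<sigma> - {w} \<union> F \<in> \<Delta> else \<sigma> \<in> \<Delta> \<and> \<not> F \<subseteq> \<sigma>)"
proof -
  have w: "w \<notin> \<tau>" if "\<tau> \<in> \<Delta>" for \<tau>
    using abstract_complexD(2)[OF assms(1) that] assms(2) by blast
  show ?thesis
  proof (cases "w \<in> \<sigma>")
    case True
    have "\<sigma> \<in> stellar F w \<Delta> \<longleftrightarrow> \<sigma> - {w} \<in> \<Delta> \<and> \<not> F \<subseteq> \<sigma> - {w} \<and> \<sigma> - {w} \<union> F \<in> \<Delta>"
    proof
      assume "\<sigma> \<in> stellar F w \<Delta>"
      then obtain \<rho> where "\<rho> \<in> \<Delta>" "\<not> F \<subseteq> \<rho>" "\<rho> \<union> F \<in> \<Delta>" "\<sigma> = insert w \<rho>"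
        using True w by (auto simp: stellar_def)
      then show "\<sigma> - {w} \<in> \<Delta> \<and> \<not> F \<subseteq> \<sigma> - {w} \<and> \<sigma> - {w} \<union> F \<in> \<Delta>"
        using w by simp
    next
      assume *: "\<sigma> - {w} \<in> \<Delta> \<and> \<not> F \<subseteq> \<sigma> - {w} \<and> \<sigma> - {w} \<union> F \<in> \<Delta>"
      have "\<sigma> = insert w (\<sigma> - {w})"
        using True by blast
      then show "\<sigma> \<in> stellar F w \<Delta>"
        using * unfolding stellar_def by blast
    qed
    moreover have "\<sigma> - {w} \<in> \<Delta>" if "\<sigma> - {w} \<union> F \<in> \<Delta>"
      using abstract_complexD(4)[OF assms(1) that] by blast
    ultimately show ?thesis
      using True by auto
  qed (auto simp: stellar_def)
qed

text \<open>A one-element \<open>F\<close> is excluded because subdividing it would delete its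
  vertex, whereas all of \<open>V\<close> has to survive.\<close>

lemma abstract_complex_stellar:
  assumes "abstract_complex V \<Delta>" "F \<in> \<Delta>" "card F \<noteq> 1" "F \<noteq> {}" "w \<notin> V"
  shows "abstract_complex (insert w V) (stellar F w \<Delta>)"
  unfolding abstract_complex_def
proof (intro conjI ballI allI impI)
  note D = abstract_complexD[OF assms(1)]
  note in_st = in_stellar[OF assms(1) \<open>w \<notin> V\<close>]
  show "finite (insert w V)"
    using D(1) by simp
  show "stellar F w \<Delta> \<noteq> {}"
    using D(6) assms(4) by (auto simp: stellar_def)
  show "stellar F w \<Delta> \<subseteq> Pow (insert w V)"
    using D(2) by (fastforce simp: stellar_def)
  show "\<tau> \<in> stellar F w \<Delta>" if "\<sigma> \<in> stellar F w \<Delta>" "\<tau> \<subseteq> \<sigma>" for \<sigma> \<tau>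
  proof (cases "w \<in> \<sigma>")
    case True
    then have *: "\<not> F \<subseteq> \<sigma> - {w}" "\<sigma> - {w} \<union> F \<in> \<Delta>"
      using that(1) by (auto simp: in_st)
    moreover have "\<tau> - {w} \<union> F \<in> \<Delta>"
      using *(2) that(2) by (elim D(4)) auto
    moreover have "\<tau> - {w} \<in> \<Delta>"
      using *(2) that(2) by (elim D(4)) auto
    moreover have "\<not> F \<subseteq> \<tau> - {w}"
      using * that by blast
    ultimately show ?thesis
      by (cases "w \<in> \<tau>") (auto simp: in_st)
  next
    case False
    then have "w \<notin> \<tau>" "\<sigma> \<in> \<Delta>" "\<not> F \<subseteq> \<sigma>"
      using that by (auto simp: in_st)
    then show ?thesis
      using that D(4) by (auto simp: in_st)
  qed
  show "{v} \<in> stellar F w \<Delta>" if "v \<in> insert w V" for v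
  proof (cases "v = w")
    case True
    then show ?thesis using assms by (auto simp: in_st)
  next
    case False
    moreover have "\<not> F \<subseteq> {v}"
      using assms(3,4) by (auto simp: subset_singleton_iff)
    ultimately show ?thesis
      using that D(5) by (auto simp: in_st)
  qed
qed

lemma polytope_simplex:
  "finite \<sigma> \<Longrightarrow> polytope (convex hull ((\<lambda>v. Poly_Mapping.single v (1::real)) ` \<sigma>))"
  by (simp add: polytope_convex_hull)

text \<open>Distances are sums of coordinate distances, so each coordinate is 1-Lipschitz.\<close>

lemma continuous_on_lookup: "continuous_on S (\<lambda>x :: 'a \<Rightarrow>\<^sub>0 real. Poly_Mapping.lookup x k)"
proof -
  have "dist (Poly_Mapping.lookup x k) (Poly_Mapping.lookup y k) \<le> dist x y" for x y :: "'a \<Rightarrow>\<^sub>0 real"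
  proof (cases "k \<in> Poly_Mapping.keys x \<union> Poly_Mapping.keys y")
    case True
    then show ?thesis
      unfolding dist_poly_mapping_def
      by (intro member_le_sum[of k _ "\<lambda>n. dist (Poly_Mapping.lookup x n) (Poly_Mapping.lookup y n)"]) auto
  next
    case False
    then show ?thesis by (simp add: in_keys_iff)
  qed
  then show ?thesis
    unfolding continuous_on_iff by (meson order_le_less_trans)
qed

text \<open>The new vertex \<open>w\<close> goes to the barycenter of \<open>F\<close> under the map \<open>g\<close>; since \<open>g\<close> is linear on
  the whole space, only its injectivity and its image have to be checked.\<close>

lemma pl_homeomorphic_stellar:
  assumes \<Delta>: "abstract_complex V \<Delta>" and F: "F \<in> \<Delta>" "card F \<noteq> 1" "F \<noteq> {}" and w: "w \<notin> V"
  shows "pl_homeomorphic (realization (stellar F w \<Delta>)) (realization \<Delta>)"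
proof -
  note D = abstract_complexD[OF \<Delta>]
  note st = abstract_complex_stellar[OF \<Delta> F w]
  note in_st = in_stellar[OF \<Delta> w]
  let ?S = "realization (stellar F w \<Delta>)" and ?T = "realization \<Delta>"
  let ?l = "Poly_Mapping.lookup :: ('a \<Rightarrow>\<^sub>0 real) \<Rightarrow> 'a \<Rightarrow> real"
  note inS = in_realization[OF st abstract_complexD(1)[OF st] order_refl]
  note inT = in_realization[OF \<Delta> abstract_complexD(1)[OF st] subset_insertI]
  have finF: "finite F" and FV: "F \<subseteq> V" and wF: "w \<notin> F"
    using D F(1) w by auto
  \<comment> \<open>\<open>c\<close> is the displacement from the unit vector of \<open>w\<close> to
    the barycenter of \<open>F\<close>. Its coordinates sum to 0, so adding multiples of it keeps
    the normalization.\<close>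
  define c where "c = (1 / card F) *\<^sub>R (\<Sum>i\<in>F. Poly_Mapping.single i (1::real)) - Poly_Mapping.single w 1"
  have lc: "?l c k = (if k \<in> F then 1 / card F else 0) - (if k = w then 1 else 0)" for k
    using finF by (auto simp: c_def lookup_minus lookup_scaleR lookup_sum lookup_single when_def sum.delta)
  have card: "real (card F) > 0"
    using finF F(3) by (simp add: card_gt_0_iff)
  have sumc: "sum (?l c) (insert w V) = 0"
  proof -
    have "sum (?l c) (insert w V) = (\<Sum>k\<in>insert w V. if k \<in> F then 1 / card F else 0)
        - (\<Sum>k\<in>insert w V. if k = w then 1 else 0)"
      unfolding lc by (rule sum_subtractf)
    also have "(\<Sum>k\<in>insert w V. if k \<in> F then 1 / card F else 0) = (\<Sum>k\<in>F. 1 / card F)"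
      using D(1) FV by (intro sum.mono_neutral_cong_right) auto
    finally show ?thesis
      using card D(1) by (simp add: sum.delta)
  qed
  define g where "g = (\<lambda>x. x + ?l x w *\<^sub>R c)"
  have lin: "linear g"
    by (rule linearI) (auto simp: g_def lookup_add lookup_scaleR scaleR_add_left algebra_simps)
  \<comment> \<open>Faces of the subdivision do not contain \<open>F\<close>, so some coordinate of
    \<open>x\<close> in \<open>F\<close> is 0, and \<open>g\<close> raises each of these coordinates
    by the \<open>w\<close>-coordinate divided by \<open>card F\<close>. Hence the least coordinate
    of \<open>g x\<close> over \<open>F\<close> recovers the \<open>w\<close>-coordinate, and
    \<open>f\<close> inverts \<open>g\<close>.\<close>
  define \<mu> where "\<mu> = (\<lambda>y. Min (?l y ` F))"
  define f where "f = (\<lambda>y. y - (card F * \<mu> y) *\<^sub>R c)"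
  have sum_shift: "sum (?l (x + r *\<^sub>R c)) (insert w V) = sum (?l x) (insert w V)" for x r
    using sumc by (simp add: lookup_add lookup_scaleR sum.distrib sum_distrib_left[symmetric] del: sum.insert)
  have \<mu>g: "\<mu> (g x) = ?l x w / card F" if x: "x \<in> ?S" for x
  proof -
    have nn: "\<And>k. 0 \<le> ?l x k" and kx: "Poly_Mapping.keys x \<in> stellar F w \<Delta>"
      using x by (auto simp: inS)
    have "\<not> F \<subseteq> Poly_Mapping.keys x"
      using kx wF by (auto simp: in_st split: if_splits)
    then obtain i where i: "i \<in> F" "?l x i = 0"
      by (auto simp: in_keys_iff)
    have lg: "?l (g x) k = ?l x k + ?l x w / card F" if "k \<in> F" for k
      using that wF by (auto simp: g_def lookup_add lookup_scaleR lc)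
    show ?thesis
      unfolding \<mu>_def
    proof (rule Min_eqI)
      show "?l x w / card F \<in> ?l (g x) ` F"
        using i lg[OF i(1)] by force
    qed (use finF lg nn in auto)
  qed
  have fg: "f (g x) = x" if "x \<in> ?S" for x
    using card by (simp add: f_def \<mu>g[OF that]) (simp add: g_def)
  have gT: "g x \<in> ?T" if x: "x \<in> ?S" for x
    unfolding inT
  proof (intro conjI allI)
    have nn: "\<And>k. 0 \<le> ?l x k" and kx: "Poly_Mapping.keys x \<in> stellar F w \<Delta>"
      and s: "sum (?l x) (insert w V) = 1"
      using x by (auto simp: inS)
    have lg: "?l (g x) k = (if k = w then 0 else ?l x k + (if k \<in> F then ?l x w / card F else 0))" for k
      using wF by (auto simp: g_def lookup_add lookup_scaleR lc)
    show "0 \<le> ?l (g x) k" for k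
      using nn by (auto simp: lg)
    show "sum (?l (g x)) (insert w V) = 1"
      unfolding g_def sum_shift by (rule s)
    show "Poly_Mapping.keys (g x) \<in> \<Delta>"
    proof (cases "w \<in> Poly_Mapping.keys x")
      case True
      have "Poly_Mapping.keys (g x) \<subseteq> Poly_Mapping.keys x - {w} \<union> F"
        by (auto simp: in_keys_iff lg split: if_splits)
      moreover have "Poly_Mapping.keys x - {w} \<union> F \<in> \<Delta>"
        using kx True by (simp add: in_st)
      ultimately show ?thesis
        using D(4) by blast
    next
      case False
      then have "g x = x"
        by (simp add: g_def in_keys_iff)
      then show ?thesis
        using kx False by (simp add: in_st)
    qed
  qed
  have fS: "f y \<in> ?S" and gf: "g (f y) = y" if y: "y \<in> ?T" for y
  proof -
    have nn: "\<And>k. 0 \<le> ?l y k" and ky: "Poly_Mapping.keys y \<in> \<Delta>"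
      and s: "sum (?l y) (insert w V) = 1"
      using y by (auto simp: inT)
    have yw: "?l y w = 0"
      using D(2)[OF ky] w by (auto simp: in_keys_iff)
    have \<mu>: "\<mu> y \<le> ?l y k" if "k \<in> F" for k
      using that finF by (auto simp: \<mu>_def)
    have "\<mu> y \<in> ?l y ` F"
      unfolding \<mu>_def using finF F(3) by (intro Min_in) auto
    then obtain i where i: "i \<in> F" "?l y i = \<mu> y"
      by auto
    have \<mu>0: "0 \<le> \<mu> y"
      using nn[of i] i by simp
    have lf: "?l (f y) k = (if k = w then card F * \<mu> y else ?l y k - (if k \<in> F then \<mu> y else 0))" for k
      using wF yw card by (auto simp: f_def lookup_minus lookup_scaleR lc)
    show "g (f y) = y"
      using card lf[of w] by (simp add: g_def) (simp add: f_def)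
    show "f y \<in> ?S"
      unfolding inS
    proof (intro conjI allI)
      show "0 \<le> ?l (f y) k" for k
        using nn \<mu> \<mu>0 by (auto simp: lf)
      have "f y = y + (- (card F * \<mu> y)) *\<^sub>R c"
        by (simp add: f_def)
      then show "sum (?l (f y)) (insert w V) = 1"
        by (simp only: sum_shift s)
      show "Poly_Mapping.keys (f y) \<in> stellar F w \<Delta>"
      proof (cases "\<mu> y = 0")
        case True
        then have "f y = y"
          by (simp add: f_def)
        moreover have "\<not> F \<subseteq> Poly_Mapping.keys y"
          using i True by (auto simp: in_keys_iff)
        ultimately show ?thesis
          using ky yw by (simp add: in_st in_keys_iff)
      next
        case False
        have "w \<in> Poly_Mapping.keys (f y)"
          using False card by (simp add: in_keys_iff lf)
        moreover have "\<not> F \<subseteq> Poly_Mapping.keys (f y)"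
        proof -
          have "?l (f y) i = 0"
            using i wF by (auto simp: lf)
          then show ?thesis
            using i(1) by (auto simp: in_keys_iff)
        qed
        moreover have "Poly_Mapping.keys (f y) - {w} \<union> F \<subseteq> Poly_Mapping.keys y"
        proof -
          have "?l y k \<noteq> 0" if "k \<in> F" for k
            using \<mu>[OF that] \<mu>0 False by linarith
          then show ?thesis
            by (auto simp: in_keys_iff lf split: if_splits)
        qed
        ultimately show ?thesis
          using D(4)[OF ky] by (auto simp: in_st)
      qed
    qed
  qed
  define sx where "sx = (\<lambda>\<sigma>. convex hull ((\<lambda>v :: 'a. Poly_Mapping.single v (1::real)) ` \<sigma>))"
  have S_sx: "?S = \<Union> (sx ` stellar F w \<Delta>)"
    by (simp add: realization_def sx_def)
  have poly: "polytope (sx \<sigma>)" if "\<sigma> \<in> stellar F w \<Delta>" for \<sigma>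
    unfolding sx_def using abstract_complexD(3)[OF st that] by (rule polytope_simplex)
  have contg: "continuous_on ?S g"
    unfolding g_def by (intro continuous_intros continuous_on_lookup)
  have "compact ?S"
    unfolding S_sx using abstract_complexD(7)[OF st] poly by (auto intro: polytope_imp_compact)
  moreover have img: "g ` ?S = ?T"
    using gT fS gf by (metis image_subset_iff image_eqI subsetI subset_antisym)
  moreover have "inj_on g ?S"
    using fg by (rule inj_on_inverseI)
  ultimately obtain f' where f': "homeomorphism ?S ?T g f'"
    using homeomorphism_compact contg by blast
  have "piecewise_linear_on ?S g"
    unfolding piecewise_linear_on_def
    using contg S_sx poly abstract_complexD(7)[OF st] lin
    by (intro conjI exI[of _ "sx ` stellar F w \<Delta>"]) (auto intro: affine_map_on_linear)
  moreover have "piecewise_linear_on ?T f'"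
    unfolding piecewise_linear_on_def
  \<comment> \<open>The inverse is affine on the images of the simplices under the linear map
    \<open>g\<close>, and these images are polytopes covering the realization of
    \<open>\<Delta>\<close>.\<close>
  proof (intro conjI exI[of _ "(\<lambda>\<sigma>. g ` sx \<sigma>) ` stellar F w \<Delta>"] ballI)
    show "continuous_on ?T f'"
      using f' by (simp add: homeomorphism_def)
    show "finite ((\<lambda>\<sigma>. g ` sx \<sigma>) ` stellar F w \<Delta>)"
      using abstract_complexD(7)[OF st] by simp
    show "\<Union> ((\<lambda>\<sigma>. g ` sx \<sigma>) ` stellar F w \<Delta>) = ?T"
      using img unfolding S_sx by blast
  next
    fix C assume "C \<in> (\<lambda>\<sigma>. g ` sx \<sigma>) ` stellar F w \<Delta>"
    then obtain \<sigma> where \<sigma>: "\<sigma> \<in> stellar F w \<Delta>" "C = g ` sx \<sigma>"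
      by blast
    show "polytope C"
      unfolding \<sigma>(2) using lin poly[OF \<sigma>(1)] by (rule polytope_linear_image)
    have f'g: "f' (g x) = x" if "x \<in> sx \<sigma>" for x
      using f' that \<sigma>(1) S_sx by (auto simp: homeomorphism_def)
    show "affine_map_on C f'"
      unfolding affine_map_on_def \<sigma>(2)
    proof clarify
      fix x y and t :: real
      assume *: "x \<in> sx \<sigma>" "y \<in> sx \<sigma>" "t \<in> {0..1}"
      then have "(1 - t) *\<^sub>R x + t *\<^sub>R y \<in> sx \<sigma>"
        using polytope_imp_convex[OF poly[OF \<sigma>(1)]] by (simp add: convex_alt)
      moreover have "(1 - t) *\<^sub>R g x + t *\<^sub>R g y = g ((1 - t) *\<^sub>R x + t *\<^sub>R y)"
        using lin by (simp add: linear_add linear_scale)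
      ultimately show "f' ((1 - t) *\<^sub>R g x + t *\<^sub>R g y) = (1 - t) *\<^sub>R f' (g x) + t *\<^sub>R f' (g y)"
        using * by (simp add: f'g)
    qed
  qed
  ultimately show ?thesis
    unfolding pl_homeomorphic_def using f' by blast
qed

section \<open>Bistellar flips\<close>

text \<open>When the link of \<open>F\<close> is the boundary of \<open>G\<close>, this exchanges
  the join of \<open>F\<close> with the boundary of \<open>G\<close> for the join of
  \<open>G\<close> with the boundary of \<open>F\<close>. Only faces containing \<open>G\<close> are
  added, since the other faces of the new ball are already present.\<close>

definition flip :: "'v set \<Rightarrow> 'v set \<Rightarrow> 'v set set \<Rightarrow> 'v set set" where
  "flip F G \<Delta> = {\<sigma> \<in> \<Delta>. \<not> F \<subseteq> \<sigma>} \<union> {G \<union> \<rho> | \<rho>. \<rho> \<subset> F}"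

locale bistellar_flip =
  fixes V :: "'v set" and \<Delta> F G
  assumes complex: "abstract_complex V \<Delta>"
    and disjoint: "F \<inter> G = {}" and nonface: "G \<notin> \<Delta>" and GV: "G \<subseteq> V"
    and cards: "card F \<noteq> 1" "card G \<noteq> 1" "F \<noteq> {}" "G \<noteq> {}"
    and link: "\<And>\<gamma>. \<gamma> \<inter> F = {} \<Longrightarrow> F \<union> \<gamma> \<in> \<Delta> \<longleftrightarrow> \<gamma> \<subset> G"
begin

lemma F_face: "F \<in> \<Delta>"
  using link[of "{}"] cards by auto

lemma in_flip: "\<sigma> \<in> flip F G \<Delta> \<longleftrightarrow> \<sigma> \<in> \<Delta> \<and> \<not> F \<subseteq> \<sigma> \<or> G \<subseteq> \<sigma> \<and> \<sigma> \<subset> F \<union> G"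
proof -
  have "(\<exists>\<rho>. \<sigma> = G \<union> \<rho> \<and> \<rho> \<subset> F) \<longleftrightarrow> G \<subseteq> \<sigma> \<and> \<sigma> \<subset> F \<union> G"
  proof
    assume "G \<subseteq> \<sigma> \<and> \<sigma> \<subset> F \<union> G"
    then have "\<sigma> = G \<union> (\<sigma> - G)" "\<sigma> - G \<subset> F"
      by auto
    then show "\<exists>\<rho>. \<sigma> = G \<union> \<rho> \<and> \<rho> \<subset> F"
      by blast
  qed (use disjoint in auto)
  then show ?thesis
    by (auto simp: flip_def)
qed

lemma abstract_complex_flip: "abstract_complex V (flip F G \<Delta>)"
  unfolding abstract_complex_def
proof (intro conjI ballI allI impI)
  note D = abstract_complexD[OF complex]
  show "finite V" by (rule D(1))
  show "flip F G \<Delta> \<noteq> {}"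
    using D(6) cards by (auto simp: flip_def)
  show "flip F G \<Delta> \<subseteq> Pow V"
    using D(2) F_face GV by (fastforce simp: in_flip)
  show "\<tau> \<in> flip F G \<Delta>" if "\<sigma> \<in> flip F G \<Delta>" "\<tau> \<subseteq> \<sigma>" for \<sigma> \<tau>
  proof (cases "\<sigma> \<in> \<Delta> \<and> \<not> F \<subseteq> \<sigma>")
    case True
    then show ?thesis
      using that D(4) by (auto simp: in_flip)
  next
    case False
    then have \<sigma>: "G \<subseteq> \<sigma>" "\<sigma> \<subset> F \<union> G"
      using that by (auto simp: in_flip)
    show ?thesis
    proof (cases "G \<subseteq> \<tau>")
      case True
      then show ?thesis
        using \<sigma> that by (auto simp: in_flip)
    next
      case False
      \<comment> \<open>The part of \<open>\<tau>\<close> outside \<open>F\<close> is a proper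
        subset of \<open>G\<close>, so by the link condition its union with \<open>F\<close> is a
        face.\<close>
      then have "\<tau> - F \<subset> G"
        using \<sigma> that by blast
      then have "F \<union> (\<tau> - F) \<in> \<Delta>"
        using link[of "\<tau> - F"] by blast
      then have "\<tau> \<in> \<Delta>"
        using D(4) by blast
      moreover have "\<not> F \<subseteq> \<tau>"
        using \<sigma> that by blast
      ultimately show ?thesis
        by (simp add: in_flip)
    qed
  qed
  show "{v} \<in> flip F G \<Delta>" if "v \<in> V" for v
  proof -
    have "\<not> F \<subseteq> {v}"
      using cards by (auto simp: subset_singleton_iff)
    then show ?thesis
      using D(5)[OF that] by (simp add: in_flip)
  qed
qed

text \<open>The two balls exchanged by the flip have the same boundary, the join of the boundaries
  of \<open>F\<close> and \<open>G\<close>, and either subdivision replaces its ball by the cone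
  over this boundary. This reduces flips to stellar subdivisions.\<close>

lemma stellar_flip:
  assumes "w \<notin> V"
  shows "stellar G w (flip F G \<Delta>) = stellar F w \<Delta>"
proof (rule set_eqI)
  fix \<sigma>
  note D = abstract_complexD[OF complex]
  show "\<sigma> \<in> stellar G w (flip F G \<Delta>) \<longleftrightarrow> \<sigma> \<in> stellar F w \<Delta>"
  proof (cases "w \<in> \<sigma>")
    case True
    let ?\<tau> = "\<sigma> - {w}"
    have "?\<tau> \<union> F \<in> \<Delta> \<longleftrightarrow> ?\<tau> - F \<subset> G"
      using link[of "?\<tau> - F"] by (simp add: Un_commute Un_Diff_cancel Int_commute)
    moreover have "?\<tau> \<union> G \<in> flip F G \<Delta> \<longleftrightarrow> ?\<tau> \<union> G \<subset> F \<union> G"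
      using D(4)[of "?\<tau> \<union> G" G] nonface by (auto simp: in_flip)
    moreover have "\<not> F \<subseteq> ?\<tau> \<and> ?\<tau> - F \<subset> G \<longleftrightarrow> \<not> G \<subseteq> ?\<tau> \<and> ?\<tau> \<union> G \<subset> F \<union> G"
      using disjoint by blast
    ultimately show ?thesis
      unfolding in_stellar[OF abstract_complex_flip assms] in_stellar[OF complex assms]
      using True by simp
  next
    case False
    then show ?thesis
      unfolding in_stellar[OF abstract_complex_flip assms] in_stellar[OF complex assms]
      using D(4)[of \<sigma> G] nonface by (auto simp: in_flip)
  qed
qed

lemma pl_homeomorphic_flip:
  assumes "infinite (UNIV :: 'v set)"
  shows "pl_homeomorphic (realization (flip F G \<Delta>)) (realization \<Delta>)"
proof -
  note D = abstract_complexD[OF complex]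
  obtain w where w: "w \<notin> V"
    using assms D(1) ex_new_if_finite by blast
  have "G \<in> flip F G \<Delta>"
    using cards disjoint by (auto simp: in_flip)
  then have "pl_homeomorphic (realization (stellar F w \<Delta>)) (realization (flip F G \<Delta>))"
    using pl_homeomorphic_stellar[OF abstract_complex_flip _ cards(2,4) w] stellar_flip[OF w] by simp
  moreover have "pl_homeomorphic (realization (stellar F w \<Delta>)) (realization \<Delta>)"
    using pl_homeomorphic_stellar[OF complex F_face cards(1,3) w] .
  ultimately show ?thesis
    using pl_homeomorphic_sym pl_homeomorphic_trans by blast
qed

end

lemma pl_homeomorphic_refl:
  assumes "finite \<Delta>" "\<And>\<sigma>. \<sigma> \<in> \<Delta> \<Longrightarrow> finite \<sigma>"
  shows "pl_homeomorphic (realization \<Delta>) (realization \<Delta>)"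
proof -
  have "piecewise_linear_on (realization \<Delta>) (\<lambda>x. x)"
    unfolding piecewise_linear_on_def
    using assms polytope_simplex
    by (intro conjI continuous_on_id exI[of _ "(\<lambda>\<sigma>. convex hull ((\<lambda>v. Poly_Mapping.single v 1) ` \<sigma>)) ` \<Delta>"])
       (auto simp: realization_def affine_map_on_def)
  then show ?thesis
    unfolding pl_homeomorphic_def using homeomorphism_ident by blast
qed

lemma pl_sphere_stellar:
  assumes "pl_sphere k V \<Delta>" "F \<in> \<Delta>" "card F \<noteq> 1" "F \<noteq> {}" "w \<notin> V"
  shows "pl_sphere k (insert w V) (stellar F w \<Delta>)"
  using assms pl_homeomorphic_stellar[of V \<Delta> F w] abstract_complex_stellar[of V \<Delta> F w] pl_homeomorphic_trans
  unfolding pl_sphere_def by blast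

lemma pl_sphere_flip:
  fixes \<Delta> :: "'v set set"
  assumes "pl_sphere k V \<Delta>" "bistellar_flip V \<Delta> F G" "infinite (UNIV :: 'v set)"
  shows "pl_sphere k V (flip F G \<Delta>)"
  using assms bistellar_flip.pl_homeomorphic_flip bistellar_flip.abstract_complex_flip pl_homeomorphic_trans
  unfolding pl_sphere_def by blast

section \<open>Moves along an edge\<close>

text \<open>The bound on cardinalities carries the dimension along as a combinatorial invariant, so
  that it need not be extracted from the PL homeomorphism.\<close>

definition full_edge :: "'v set \<Rightarrow> 'v set set \<Rightarrow> 'v \<Rightarrow> 'v \<Rightarrow> bool" where
  "full_edge V \<Delta> u t \<longleftrightarrow>
     pl_sphere 4 V \<Delta> \<and> (\<forall>\<sigma>\<in>\<Delta>. card \<sigma> \<le> 5) \<and> u \<in> V \<and> t \<in> V \<and> u \<noteq> t \<and>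
     (\<forall>a\<in>V. \<forall>b\<in>V. {a, b} \<in> \<Delta>) \<and> (\<forall>a\<in>V. {u, t, a} \<in> \<Delta>)"

text \<open>These are the missing triangles of the link of \<open>{u, t}\<close> that are faces of
  \<open>\<Delta>\<close>. Being a face matters because a missing 3-face formed by \<open>T\<close>
  and a new vertex must have \<open>T\<close> among its proper faces.\<close>

definition link_missing :: "'v set set \<Rightarrow> 'v \<Rightarrow> 'v \<Rightarrow> 'v set set" where
  "link_missing \<Delta> u t =
     {T \<in> \<Delta>. card T = 3 \<and> u \<notin> T \<and> t \<notin> T \<and> (\<forall>a\<in>T. \<forall>b\<in>T. {u, t, a, b} \<in> \<Delta>) \<and> {u, t} \<union> T \<notin> \<Delta>}"

text \<open>Let \<open>R\<close> be a disc in the link \<open>L\<close> of the edge \<open>e\<close>, with \<open>\<iota>\<close> its least interior face.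
  The move replaces the ball \<open>e * (L \<setminus> R)\<close> by the cone with apex \<open>v\<close> over its boundary.\<close>

definition edge_move :: "'v set \<Rightarrow> 'v set set \<Rightarrow> 'v set \<Rightarrow> 'v \<Rightarrow> 'v set set \<Rightarrow> 'v set set" where
  "edge_move e R \<iota> v \<Delta> =
     {\<sigma>. if v \<in> \<sigma> then \<not> \<iota> \<subseteq> \<sigma> \<and> (if e \<subseteq> \<sigma> then \<sigma> - e - {v} \<in> R else \<sigma> - {v} \<union> e \<in> \<Delta>)
         else \<sigma> \<in> \<Delta> \<and> (e \<subseteq> \<sigma> \<longrightarrow> \<sigma> - e \<in> R)}"

text \<open>The two instances are a single triangle, with itself as \<open>\<iota>\<close>, and two
  triangles, with their common edge as \<open>\<iota>\<close>. By \<open>R_induced\<close>, every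
  edge of the link between vertices of the disc lies in the disc; for two triangles this is the
  non-adjacency of the opposite vertices. By \<open>R_card\<close>, every triangle of the disc
  contains \<open>\<iota>\<close>.\<close>

locale edge_move_setup =
  fixes V :: "'v set" and \<Delta> :: "'v set set" and u t v :: 'v and R :: "'v set set" and \<iota> :: "'v set"
  assumes full: "full_edge V \<Delta> u t" and v: "v \<notin> V"
    and R_empty: "{} \<in> R"
    and R_link: "\<rho> \<in> R \<Longrightarrow> u \<notin> \<rho> \<and> t \<notin> \<rho> \<and> insert u (insert t \<rho>) \<in> \<Delta>"
    and R_induced: "{a} \<in> R \<Longrightarrow> {b} \<in> R \<Longrightarrow> {u, t, a, b} \<in> \<Delta> \<Longrightarrow> {a, b} \<in> R"
    and R_card: "\<rho> \<in> R \<Longrightarrow> \<not> \<iota> \<subseteq> \<rho> \<Longrightarrow> card \<rho> \<le> 2"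
    and \<iota>: "card \<iota> \<ge> 2" "u \<notin> \<iota>" "t \<notin> \<iota>" "\<iota> \<subseteq> V"
begin

abbreviation \<Delta>' where "\<Delta>' \<equiv> edge_move {u, t} R \<iota> v \<Delta>"

lemma complex: "abstract_complex V \<Delta>"
  using full by (simp add: full_edge_def pl_sphere_def)

lemmas cD = abstract_complexD[OF complex]

lemma ut: "u \<in> V" "t \<in> V" "u \<noteq> t" "u \<noteq> v" "t \<noteq> v"
  using full v by (auto simp: full_edge_def)

lemma pair: "a \<in> V \<Longrightarrow> b \<in> V \<Longrightarrow> {a, b} \<in> \<Delta>"
  and triple: "a \<in> V \<Longrightarrow> {u, t, a} \<in> \<Delta>"
  and dim: "\<sigma> \<in> \<Delta> \<Longrightarrow> card \<sigma> \<le> 5"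
  using full by (auto simp: full_edge_def)

lemma not_\<iota>_singleton: "\<not> \<iota> \<subseteq> {u, t, v, a}"
proof
  assume "\<iota> \<subseteq> {u, t, v, a}"
  then have "\<iota> \<subseteq> {a}" using \<iota> v by auto
  then have "card \<iota> \<le> 1" using card_mono[of "{a}" \<iota>] by simp
  then show False using \<iota> by simp
qed

lemma old: "v \<notin> \<sigma> \<Longrightarrow> \<sigma> \<in> \<Delta>' \<longleftrightarrow> \<sigma> \<in> \<Delta> \<and> (u \<in> \<sigma> \<longrightarrow> t \<in> \<sigma> \<longrightarrow> \<sigma> - {u, t} \<in> R)"
  by (auto simp: edge_move_def)

lemma new: "v \<notin> \<sigma> \<Longrightarrow> \<not> {u, t} \<subseteq> \<sigma> \<Longrightarrow>
    insert v \<sigma> \<in> \<Delta>' \<longleftrightarrow> \<not> \<iota> \<subseteq> \<sigma> \<and> insert u (insert t \<sigma>) \<in> \<Delta>"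
  using \<iota> v ut by (auto simp: edge_move_def)

lemma new_edge: "v \<notin> \<sigma> \<Longrightarrow> u \<notin> \<sigma> \<Longrightarrow> t \<notin> \<sigma> \<Longrightarrow>
    insert u (insert v (insert t \<sigma>)) \<in> \<Delta>' \<longleftrightarrow> \<not> \<iota> \<subseteq> \<sigma> \<and> \<sigma> \<in> R"
proof -
  assume *: "v \<notin> \<sigma>" "u \<notin> \<sigma>" "t \<notin> \<sigma>"
  have "\<iota> \<subseteq> insert u (insert v (insert t \<sigma>)) \<longleftrightarrow> \<iota> \<subseteq> \<sigma>"
    using \<iota> v by auto
  moreover have "insert u (insert v (insert t \<sigma>)) - {u, t} - {v} = \<sigma>"
    using * by auto
  ultimately show ?thesis by (auto simp: edge_move_def)
qed

text \<open>Being a PL sphere is a hypothesis here because it is obtained from flips, separately for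
  each of the two moves.\<close>

lemma full_edge_move:
  assumes "pl_sphere 4 (insert v V) \<Delta>'"
  shows "full_edge (insert v V) \<Delta>' u v"
  unfolding full_edge_def
proof (intro conjI ballI)
  show "pl_sphere 4 (insert v V) \<Delta>'" by fact
  show "card \<sigma> \<le> 5" if "\<sigma> \<in> \<Delta>'" for \<sigma>
  proof (cases "v \<in> \<sigma>")
    case False
    then show ?thesis using that dim by (simp add: old)
  next
    case True
    define \<tau> where "\<tau> = \<sigma> - {v}"
    have \<tau>: "\<sigma> = insert v \<tau>" "v \<notin> \<tau>"
      using True by (auto simp: \<tau>_def)
    show ?thesis
    proof (cases "{u, t} \<subseteq> \<tau>")
      case True
      define \<rho> where "\<rho> = \<tau> - {u, t}"
      have \<rho>: "\<sigma> = insert u (insert v (insert t \<rho>))" "u \<notin> \<rho>" "t \<notin> \<rho>" "v \<notin> \<rho>"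
        using True \<tau> by (auto simp: \<rho>_def)
      then have "\<rho> \<in> R" "\<not> \<iota> \<subseteq> \<rho>"
        using that new_edge[of \<rho>] by auto
      then have "card \<rho> \<le> 2" "finite \<rho>"
        using R_card R_link cD(3)[of "insert u (insert t \<rho>)"] by auto
      then show ?thesis
        using \<rho> ut by simp
    next
      case False
      then have *: "insert u (insert t \<tau>) \<in> \<Delta>"
        using that new[of \<tau>] \<tau> by auto
      \<comment> \<open>A face on \<open>v\<close> without the whole edge has one vertex fewer after
        deleting \<open>v\<close>, and at least one more after adding \<open>u\<close> and
        \<open>t\<close>, so the bound 5 is inherited.\<close>
      have "\<tau> \<subset> insert u (insert t \<tau>)"
        using False by blast
      then have "card \<tau> < card (insert u (insert t \<tau>))"
        using cD(3)[OF *] by (rule psubset_card_mono[rotated])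
      then show ?thesis
        using dim[OF *] cD(3)[OF *] \<tau> by simp
    qed
  qed
  show "u \<in> insert v V" "v \<in> insert v V" "u \<noteq> v"
    using ut by auto
  have va: "{v, a} \<in> \<Delta>'" if "a \<in> V" for a
  proof -
    have "a \<noteq> v" using v that by auto
    moreover have "\<not> \<iota> \<subseteq> {a}" using not_\<iota>_singleton[of a] by blast
    ultimately show ?thesis
      using new[of "{a}"] triple[OF that] ut by auto
  qed
  have vv: "{v} \<in> \<Delta>'"
  proof -
    have "\<not> \<iota> \<subseteq> {}" using not_\<iota>_singleton[of u] by blast
    then show ?thesis
      using new[of "{}"] pair[OF ut(1,2)] by auto
  qed
  show "{a, b} \<in> \<Delta>'" if "a \<in> insert v V" "b \<in> insert v V" for a b
  proof (cases "a = v \<or> b = v")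
    case True
    then show ?thesis
      using that va vv by (auto simp: insert_commute)
  next
    case False
    then have ab: "v \<notin> {a, b}" "a \<in> V" "b \<in> V" using that by auto
    have "{a, b} - {u, t} \<in> R" if "u \<in> {a, b}" "t \<in> {a, b}"
    proof -
      have "{a, b} - {u, t} = {}" using that ut by auto
      then show ?thesis using R_empty by simp
    qed
    then show ?thesis
      using old[OF ab(1)] pair ab by auto
  qed
  show "{u, v, a} \<in> \<Delta>'" if a: "a \<in> insert v V" for a
  proof (cases "a = t")
    case True
    have "\<not> \<iota> \<subseteq> {}" using not_\<iota>_singleton[of u] by blast
    then show ?thesis
      using new_edge[of "{}"] True R_empty by simp
  next
    case False
    have "\<not> \<iota> \<subseteq> {u, a}" "\<not> \<iota> \<subseteq> {u}"
      using not_\<iota>_singleton[of a] by auto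
    then show ?thesis
      using a False new[of "{u, a}"] new[of "{u}"] triple[of a] pair[of u t] ut
      by (cases "a = v") (auto simp: insert_commute)
  qed
qed

section \<open>Missing triangles and missing 3-faces after a move\<close>

text \<open>In the new link the disc is replaced by the cone with apex \<open>t\<close> over its
  boundary. A missing triangle through \<open>t\<close> would have its other two vertices, and by
  \<open>R_induced\<close> also their edge, in the disc, and would thus be filled. What remains are
  triangles whose edges all survive and that either were missing before or have been destroyed
  together with \<open>\<iota>\<close>.\<close>

lemma link_missing_move: "link_missing \<Delta>' u v =
    {T \<in> \<Delta>. card T = 3 \<and> u \<notin> T \<and> t \<notin> T \<and> (\<forall>a\<in>T. \<forall>b\<in>T. {u, t, a, b} \<in> \<Delta> \<and> \<not> \<iota> \<subseteq> {a, b}) \<and>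
       ({u, t} \<union> T \<notin> \<Delta> \<or> \<iota> \<subseteq> T)}" (is "_ = ?S")
proof (intro equalityI subsetI)
  fix T assume "T \<in> link_missing \<Delta>' u v"
  then have T: "T \<in> \<Delta>'" "card T = 3" "u \<notin> T" "v \<notin> T"
    and pairs: "\<And>a b. a \<in> T \<Longrightarrow> b \<in> T \<Longrightarrow> {u, v, a, b} \<in> \<Delta>'" and nf: "{u, v} \<union> T \<notin> \<Delta>'"
    by (auto simp: link_missing_def)
  have "t \<notin> T"
  proof
    assume "t \<in> T"
    have "card (T - {t}) = 2"
      using T \<open>t \<in> T\<close> by simp
    then obtain a b where ab: "T - {t} = {a, b}" "a \<noteq> b"
      by (meson card_2_iff)
    have ne: "a \<noteq> t" "b \<noteq> t" "a \<noteq> u" "b \<noteq> u" "a \<noteq> v" "b \<noteq> v" "a \<in> T" "b \<in> T"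
      using ab T by auto
    have "{a} \<in> R" "{b} \<in> R"
      using pairs[OF \<open>t \<in> T\<close>, of a] pairs[OF \<open>t \<in> T\<close>, of b] new_edge[of "{a}"] new_edge[of "{b}"] ne ut
      by (auto simp: insert_commute)
    moreover have ab': "{u, t, a, b} \<in> \<Delta>" "\<not> \<iota> \<subseteq> {u, a, b}"
      using pairs[of a b] new[of "{u, a, b}"] ne ut by (auto simp: insert_commute)
    ultimately have "{a, b} \<in> R"
      using R_induced by simp
    then have "{u, v, t, a, b} \<in> \<Delta>'"
      using new_edge[of "{a, b}"] ne ab' by auto
    moreover have "{u, v} \<union> T = {u, v, t, a, b}"
      using ab \<open>t \<in> T\<close> by auto
    ultimately show False using nf by simp
  qed
  have "{u, t, a, b} \<in> \<Delta> \<and> \<not> \<iota> \<subseteq> {u, a, b}" if "a \<in> T" "b \<in> T" for a b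
    using pairs[OF that] new[of "{u, a, b}"] that T \<open>t \<notin> T\<close> ut by (auto simp: insert_commute)
  moreover have "{u, t} \<union> T \<notin> \<Delta> \<or> \<iota> \<subseteq> T"
  proof -
    have "\<iota> \<subseteq> insert u T \<longleftrightarrow> \<iota> \<subseteq> T" using \<iota> by auto
    then show ?thesis
      using nf new[of "insert u T"] T \<open>t \<notin> T\<close> ut by (auto simp: insert_commute)
  qed
  ultimately show "T \<in> ?S"
    using T \<open>t \<notin> T\<close> old[OF T(4)] by blast
next
  fix T assume "T \<in> ?S"
  then have T: "T \<in> \<Delta>" "card T = 3" "u \<notin> T" "t \<notin> T"
    and pairs: "\<And>a b. a \<in> T \<Longrightarrow> b \<in> T \<Longrightarrow> {u, t, a, b} \<in> \<Delta> \<and> \<not> \<iota> \<subseteq> {a, b}"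
    and nf: "{u, t} \<union> T \<notin> \<Delta> \<or> \<iota> \<subseteq> T"
    by auto
  have "v \<notin> T" using cD(2)[OF T(1)] v by auto
  have \<iota>u: "\<iota> \<subseteq> insert u A \<longleftrightarrow> \<iota> \<subseteq> A" for A
    using \<iota> by auto
  have "{u, v, a, b} \<in> \<Delta>'" if "a \<in> T" "b \<in> T" for a b
  proof -
    have "\<not> \<iota> \<subseteq> {u, a, b}"
      using pairs[OF that] \<iota>u[of "{a, b}"] by simp
    then show ?thesis
      using pairs[OF that] new[of "{u, a, b}"] that T \<open>v \<notin> T\<close> ut by (auto simp: insert_commute)
  qed
  moreover have "{u, v} \<union> T \<notin> \<Delta>'"
    using nf new[of "insert u T"] T \<open>v \<notin> T\<close> ut by (auto simp: insert_commute \<iota>u)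
  moreover have "T \<in> \<Delta>'"
    using T \<open>v \<notin> T\<close> by (simp add: old)
  ultimately show "T \<in> link_missing \<Delta>' u v"
    using T \<open>v \<notin> T\<close> by (auto simp: link_missing_def)
qed

text \<open>The hypothesis says that a missing 3-face through \<open>{u, t}\<close> loses one of its
  triangles on this edge, so it is no longer missing. It holds vacuously along the main sequence of
  moves and is used properly only to build the sphere with 9 vertices.\<close>

lemma missing_faces_move:
  assumes unkept: "\<And>F. F \<in> missing_faces 3 V \<Delta> \<Longrightarrow> u \<in> F \<Longrightarrow> t \<in> F \<Longrightarrow> \<exists>a\<in>F - {u, t}. {a} \<notin> R"
  shows "missing_faces 3 (insert v V) \<Delta>' =
    {F \<in> missing_faces 3 V \<Delta>. \<not> {u, t} \<subseteq> F} \<union> insert v ` link_missing \<Delta>' u v"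
proof (intro equalityI subsetI)
  fix F assume "F \<in> missing_faces 3 (insert v V) \<Delta>'"
  then have F: "F \<subseteq> insert v V" "card F = 4" "F \<notin> \<Delta>'" and sub: "\<And>G. G \<subset> F \<Longrightarrow> G \<in> \<Delta>'"
    by (auto simp: missing_faces_def)
  show "F \<in> {F \<in> missing_faces 3 V \<Delta>. \<not> {u, t} \<subseteq> F} \<union> insert v ` link_missing \<Delta>' u v"
  proof (cases "v \<in> F")
    case False
    have single: "{a} \<in> R" if "u \<in> F" "t \<in> F" "a \<in> F - {u, t}" for a
    proof -
      have "card {u, t, a} < card F"
        using F(2) card_insert_le_m1[of 3 "{t, a}" u] by (auto simp: card_insert_if)
      then have "{u, t, a} \<subset> F"
        using that by auto
      then show ?thesis
        using sub[of "{u, t, a}"] old[of "{u, t, a}"] that False by (auto simp: insert_Diff_if)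
    qed
    \<comment> \<open>A former face that was removed would contain \<open>{u, t}\<close> and have
      its other two vertices in the disc; by \<open>R_induced\<close> their edge is then in the disc
      as well, so the face would have been kept.\<close>
    have "F \<notin> \<Delta>"
    proof
      assume "F \<in> \<Delta>"
      then have *: "u \<in> F" "t \<in> F" "F - {u, t} \<notin> R"
        using F(3) old[OF False] by auto
      have "card (F - {u, t}) = 2"
        using * F(2) ut(3) by (simp add: card_Diff_subset)
      then obtain a b where ab: "F - {u, t} = {a, b}"
        by (meson card_2_iff)
      then have "{u, t, a, b} \<in> \<Delta>"
        using \<open>F \<in> \<Delta>\<close> * cD(4)[OF \<open>F \<in> \<Delta>\<close>, of "{u, t, a, b}"] by auto
      then have "{a, b} \<in> R"
        using R_induced single * ab by auto
      then show False using * ab by simp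
    qed
    moreover have "G \<in> \<Delta>" if "G \<subset> F" for G
      using sub[OF that] old[of G] False that by auto
    ultimately have "F \<in> missing_faces 3 V \<Delta>"
      using F False by (auto simp: missing_faces_def)
    then show ?thesis
      using unkept[of F] single by auto
  next
    case True
    define T where "T = F - {v}"
    have T: "F = insert v T" "v \<notin> T" "card T = 3" "T \<subseteq> V"
      using True F by (auto simp: T_def)
    have "finite T" using T(3) card.infinite by fastforce
    have "T \<in> \<Delta>'" using sub[of T] T by auto
    have vpair: "{v, a, b} \<in> \<Delta>'" if "a \<in> T" "b \<in> T" for a b
    proof (rule sub)
      have "card {a, b} < card T" using T(3) by (simp add: card_insert_if)
      then have "{a, b} \<subset> T" using that by auto
      then show "{v, a, b} \<subset> F" using T by auto
    qed
    have not_both: "\<not> (u \<in> T \<and> t \<in> T)"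
    proof
      assume *: "u \<in> T \<and> t \<in> T"
      then have "card (T - {u, t}) = 1"
        using T ut(3) by (simp add: card_Diff_subset)
      then obtain c where c: "T - {u, t} = {c}"
        by (auto simp: card_1_singleton_iff)
      then have "{c} \<in> R" "c \<noteq> u" "c \<noteq> t" "c \<noteq> v"
        using \<open>T \<in> \<Delta>'\<close> old[OF T(2)] * T by auto
      moreover have "\<not> \<iota> \<subseteq> {c}" using not_\<iota>_singleton[of c] by auto
      ultimately have "{u, v, t, c} \<in> \<Delta>'"
        using new_edge[of "{c}"] by auto
      moreover have "F = {u, v, t, c}"
        using T c * by auto
      ultimately show False using F by simp
    qed
    \<comment> \<open>If \<open>T\<close> contains exactly one of \<open>u\<close> and
      \<open>t\<close>, adding both to it gives the same set as adding them to the other two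
      vertices of \<open>T\<close>, so \<open>F\<close> is already filled.\<close>
    have step: False if s: "s \<in> T" "s = u \<or> s = t" for s
    proof -
      have "card (T - {s}) = 2"
        using T s by simp
      then obtain a b where ab: "T - {s} = {a, b}"
        by (meson card_2_iff)
      have ne: "a \<in> T" "b \<in> T" "a \<noteq> u" "b \<noteq> u" "a \<noteq> t" "b \<noteq> t" "a \<noteq> v" "b \<noteq> v"
        using ab s not_both T by auto
      have *: "\<not> \<iota> \<subseteq> {a, b}" "{u, t, a, b} \<in> \<Delta>"
        using vpair[OF ne(1,2)] new[of "{a, b}"] ne by auto
      have "T = {s, a, b}" using ab s by auto
      moreover have "\<not> \<iota> \<subseteq> {s, a, b}"
        using * \<iota> s by auto
      moreover have "insert u (insert t {s, a, b}) = {u, t, a, b}"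
        using s by auto
      ultimately have "insert v T \<in> \<Delta>'"
        using new[of T] T not_both * by auto
      then show False using F T by simp
    qed
    then have uT: "u \<notin> T" "t \<notin> T" by auto
    have "\<not> \<iota> \<subseteq> {a, b} \<and> {u, t, a, b} \<in> \<Delta>" if "a \<in> T" "b \<in> T" for a b
      using vpair[OF that] new[of "{a, b}"] that uT T by auto
    moreover have "{u, t} \<union> T \<notin> \<Delta> \<or> \<iota> \<subseteq> T"
      using F(3) new[of T] T uT by auto
    moreover have "T \<in> \<Delta>"
      using \<open>T \<in> \<Delta>'\<close> old[OF T(2)] by simp
    ultimately have "T \<in> link_missing \<Delta>' u v"
      unfolding link_missing_move using T uT by auto
    then show ?thesis using T by auto
  qed
next
  fix F assume "F \<in> {F \<in> missing_faces 3 V \<Delta>. \<not> {u, t} \<subseteq> F} \<union> insert v ` link_missing \<Delta>' u v"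
  then consider "F \<in> missing_faces 3 V \<Delta>" "\<not> {u, t} \<subseteq> F"
    | T where "F = insert v T" "T \<in> link_missing \<Delta>' u v"
    by blast
  then show "F \<in> missing_faces 3 (insert v V) \<Delta>'"
  proof cases
    case 1
    then have F: "F \<subseteq> V" "card F = 4" "F \<notin> \<Delta>" and sub: "\<And>G. G \<subset> F \<Longrightarrow> G \<in> \<Delta>"
      by (auto simp: missing_faces_def)
    have "v \<notin> F" using F v by auto
    then have "F \<notin> \<Delta>'" using F by (simp add: old)
    moreover have "G \<in> \<Delta>'" if "G \<subset> F" for G
    proof -
      have "v \<notin> G" "\<not> {u, t} \<subseteq> G" using that \<open>v \<notin> F\<close> 1 by auto
      then show ?thesis using sub[OF that] by (auto simp: old)
    qed
    ultimately show ?thesis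
      using F by (auto simp: missing_faces_def)
  next
    case 2
    then have T: "T \<in> \<Delta>" "card T = 3" "u \<notin> T" "t \<notin> T"
      and pairs: "\<And>a b. a \<in> T \<Longrightarrow> b \<in> T \<Longrightarrow> {u, t, a, b} \<in> \<Delta> \<and> \<not> \<iota> \<subseteq> {a, b}"
      and nf: "{u, t} \<union> T \<notin> \<Delta> \<or> \<iota> \<subseteq> T"
      unfolding link_missing_move by auto
    have "T \<subseteq> V" "v \<notin> T" "finite T" using cD(2,3)[OF T(1)] v by auto
    have "F \<notin> \<Delta>'"
      using 2 nf new[of T] T \<open>v \<notin> T\<close> by auto
    moreover have "G \<in> \<Delta>'" if "G \<subset> F" for G
    proof (cases "v \<in> G")
      case False
      then have "G \<subseteq> T" using that 2 by auto
      then show ?thesis using cD(4)[OF T(1)] T False by (auto simp: old)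
    next
      case True
      define H where "H = G - {v}"
      have H: "G = insert v H" "v \<notin> H" "H \<subset> T"
        using True that 2 \<open>v \<notin> T\<close> by (auto simp: H_def)
      then obtain c where c: "c \<in> T" "H \<subseteq> T - {c}" by blast
      have "card (T - {c}) = 2"
        using T c by simp
      then obtain a b where ab: "T - {c} = {a, b}"
        by (meson card_2_iff)
      then have "{u, t, a, b} \<in> \<Delta>" "\<not> \<iota> \<subseteq> {a, b}" "H \<subseteq> {a, b}"
        using pairs[of a b] c by auto
      then have "insert u (insert t H) \<in> \<Delta>" "\<not> \<iota> \<subseteq> H" "\<not> {u, t} \<subseteq> H"
        using cD(4)[of "{u, t, a, b}" "insert u (insert t H)"] H T by auto
      then show ?thesis using H new[of H] by auto
    qed
    moreover have "card F = 4" "F \<subseteq> insert v V"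
      using 2 T \<open>v \<notin> T\<close> \<open>finite T\<close> \<open>T \<subseteq> V\<close> by auto
    ultimately show ?thesis
      by (auto simp: missing_faces_def)
  qed
qed

end

section \<open>Edges of the link and their opposite vertices\<close>

text \<open>This records that exactly two triangles of the link of \<open>{u, t}\<close> contain the
  edge \<open>{x, y}\<close>, with opposite vertices \<open>p\<close> and \<open>q\<close>, as is
  the case in a triangulated surface.\<close>

definition link_edge :: "'v set set \<Rightarrow> 'v \<Rightarrow> 'v \<Rightarrow> 'v \<Rightarrow> 'v \<Rightarrow> 'v \<Rightarrow> 'v \<Rightarrow> bool" where
  "link_edge \<Delta> u t x y p q \<longleftrightarrow> distinct [u, t, x, y, p, q] \<and>
     (\<forall>a. a \<notin> {u, t, x, y} \<longrightarrow> {u, t, x, y, a} \<in> \<Delta> \<longleftrightarrow> a = p \<or> a = q)"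

lemma link_edge_facets:
  assumes "link_edge \<Delta> u t x y p q"
  shows "{u, t, x, y, p} \<in> \<Delta>" "{u, t, x, y, q} \<in> \<Delta>"
  using assms by (auto simp: link_edge_def)

context edge_move_setup
begin

text \<open>This serves the second tracked edge: it lies outside the disc, and neither it nor any
  triangle at it contains \<open>\<iota>\<close>, so the move leaves its two triangles
  alone.\<close>

lemma link_edge_move:
  assumes le: "link_edge \<Delta> u t z w p q" and "{z, w} \<notin> R" "\<And>a. \<not> \<iota> \<subseteq> {z, w, a}"
  shows "link_edge \<Delta>' u v z w p q"
proof -
  have V: "{u, t, z, w, p, q} \<subseteq> V"
    using link_edge_facets[OF le] cD(2) by blast
  then have v': "v \<notin> {u, t, z, w, p, q}"
    using v by blast
  have dist: "distinct [u, t, z, w, p, q]"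
    and faces: "\<And>a. a \<notin> {u, t, z, w} \<Longrightarrow> {u, t, z, w, a} \<in> \<Delta> \<longleftrightarrow> a = p \<or> a = q"
    using le by (auto simp: link_edge_def)
  have "{u, v, z, w, a} \<in> \<Delta>' \<longleftrightarrow> a = p \<or> a = q" if "a \<notin> {u, v, z, w}" for a
  proof (cases "a = t")
    case True
    have "insert u (insert v (insert t {z, w})) \<in> \<Delta>' \<longleftrightarrow> \<not> \<iota> \<subseteq> {z, w} \<and> {z, w} \<in> R"
      using dist v' by (intro new_edge) auto
    moreover have "insert u (insert v (insert t {z, w})) = {u, v, z, w, a}"
      using True by auto
    ultimately show ?thesis
      using True dist assms(2) by auto
  next
    case False
    have "insert v {u, z, w, a} \<in> \<Delta>' \<longleftrightarrow> \<not> \<iota> \<subseteq> {u, z, w, a} \<and> insert u (insert t {u, z, w, a}) \<in> \<Delta>"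
      using dist v' that False by (intro new) auto
    moreover have "insert v {u, z, w, a} = {u, v, z, w, a}"
        "insert u (insert t {u, z, w, a}) = {u, t, z, w, a}"
      by auto
    moreover have "\<not> \<iota> \<subseteq> {u, z, w, a}"
      using assms(3)[of a] \<iota>(2) by blast
    ultimately show ?thesis
      using faces[of a] False that by auto
  qed
  then show ?thesis
    using dist v' by (auto simp: link_edge_def)
qed

lemma link_nonedge_move:
  assumes "{u, t, a, b} \<notin> \<Delta>" "a \<notin> {u, t, v}" "b \<notin> {u, t, v}"
  shows "{u, v, a, b} \<notin> \<Delta>'"
proof -
  have "insert v {u, a, b} \<in> \<Delta>' \<longleftrightarrow> \<not> \<iota> \<subseteq> {u, a, b} \<and> insert u (insert t {u, a, b}) \<in> \<Delta>"
    using assms ut by (intro new) auto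
  moreover have "insert v {u, a, b} = {u, v, a, b}" "insert u (insert t {u, a, b}) = {u, t, a, b}"
    by auto
  ultimately show ?thesis
    using assms by simp
qed

text \<open>The second claim restores the invariant for the next move along \<open>{u, v}\<close>:
  missing faces on \<open>v\<close> come from triangles that avoid \<open>u\<close>.\<close>

lemma num_missing_faces_move:
  assumes "\<And>F. F \<in> missing_faces 3 V \<Delta> \<Longrightarrow> u \<in> F \<Longrightarrow> t \<in> F \<Longrightarrow> \<exists>a\<in>F - {u, t}. {a} \<notin> R"
  shows "num_missing_faces 3 (insert v V) \<Delta>' =
      card {F \<in> missing_faces 3 V \<Delta>. \<not> {u, t} \<subseteq> F} + card (link_missing \<Delta>' u v)" (is ?thesis1)
    and "F \<in> missing_faces 3 (insert v V) \<Delta>' \<Longrightarrow> \<not> {u, v} \<subseteq> F"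
proof -
  let ?M = "{F \<in> missing_faces 3 V \<Delta>. \<not> {u, t} \<subseteq> F}" and ?N = "link_missing \<Delta>' u v"
  have mf: "missing_faces 3 (insert v V) \<Delta>' = ?M \<union> insert v ` ?N"
    by (rule missing_faces_move) (rule assms)
  have M: "F \<subseteq> V" if "F \<in> ?M" for F
    using that by (auto simp: missing_faces_def)
  have N: "v \<notin> T" "u \<notin> T" "T \<in> \<Delta>" if "T \<in> ?N" for T
    using that by (auto simp: link_missing_def old)
  have "finite ?M"
    using M cD(1) by (meson finite_Pow_iff finite_subset PowI subsetI)
  moreover have "finite ?N"
    using N(3) cD(7) by (meson finite_subset subsetI)
  moreover have "?M \<inter> insert v ` ?N = {}"
    using M v by blast
  moreover have "inj_on (insert v) ?N"
    using N(1) by (intro inj_onI) (metis Diff_insert_absorb)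
  ultimately show ?thesis1
    unfolding num_missing_faces_def mf
    by (simp add: card_Un_disjoint card_image)
  show "F \<in> missing_faces 3 (insert v V) \<Delta>' \<Longrightarrow> \<not> {u, v} \<subseteq> F"
    unfolding mf using M N v ut by blast
qed

end

section \<open>Stacking a triangle and cutting an edge\<close>

locale full_link_edge =
  fixes V :: "nat set" and \<Delta> u t x y p q v
  assumes full: "full_edge V \<Delta> u t" and le: "link_edge \<Delta> u t x y p q" and v: "v \<notin> V"
begin

lemma complex: "abstract_complex V \<Delta>"
  using full by (simp add: full_edge_def pl_sphere_def)

lemmas cD = abstract_complexD[OF complex]

lemma dist: "distinct [u, t, x, y, p, q, v]" and V: "{u, t, x, y, p, q} \<subseteq> V"
proof -
  show V: "{u, t, x, y, p, q} \<subseteq> V"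
    using link_edge_facets[OF le] cD(2) by blast
  then show "distinct [u, t, x, y, p, q, v]"
    using le v by (auto simp: link_edge_def)
qed

lemma neq: "u \<noteq> t" "u \<noteq> x" "u \<noteq> y" "u \<noteq> p" "u \<noteq> q" "u \<noteq> v" "t \<noteq> x" "t \<noteq> y" "t \<noteq> p" "t \<noteq> q" "t \<noteq> v"
   "x \<noteq> y" "x \<noteq> p" "x \<noteq> q" "x \<noteq> v" "y \<noteq> p" "y \<noteq> q" "y \<noteq> v" "p \<noteq> q" "p \<noteq> v" "q \<noteq> v"
  using dist by auto

lemmas neqs = neq neq[symmetric]

lemma facets: "{u, t, x, y, p} \<in> \<Delta>" "{u, t, x, y, q} \<in> \<Delta>"
  by (rule link_edge_facets[OF le])+

lemma apex: "a \<in> \<sigma> \<Longrightarrow> a \<notin> {u, t, x, y} \<Longrightarrow> {u, t, x, y} \<subseteq> \<sigma> \<Longrightarrow> \<sigma> \<in> \<Delta> \<Longrightarrow> a = p \<or> a = q"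
proof -
  assume *: "a \<in> \<sigma>" "a \<notin> {u, t, x, y}" "{u, t, x, y} \<subseteq> \<sigma>" "\<sigma> \<in> \<Delta>"
  then have "{u, t, x, y, a} \<in> \<Delta>"
    using cD(4)[OF *(4)] by auto
  then show ?thesis
    using * le by (auto simp: link_edge_def)
qed

lemma dim: "\<sigma> \<in> \<Delta> \<Longrightarrow> card \<sigma> \<le> 5"
  using full by (simp add: full_edge_def)

lemma not_both: "{u, t, x, y, p, q} \<subseteq> \<sigma> \<Longrightarrow> \<sigma> \<notin> \<Delta>"
proof
  assume *: "{u, t, x, y, p, q} \<subseteq> \<sigma>" "\<sigma> \<in> \<Delta>"
  then have "card {u, t, x, y, p, q} \<le> 5"
    using dim cD(3) card_mono by (meson le_trans)
  then show False
    using dist by simp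
qed

lemma facet_maximal: "\<sigma> \<in> \<Delta> \<Longrightarrow> {u, t, x, y, p} \<subseteq> \<sigma> \<Longrightarrow> \<sigma> = {u, t, x, y, p}"
  using apex[of _ \<sigma>] not_both[of \<sigma>] by blast

text \<open>Writing \<open>L\<close> for the link of \<open>{u, t}\<close>, the link of \<open>{u, v}\<close> after the move is \<open>L\<close> with
  \<open>t\<close> stacked onto the triangle \<open>{x, y, p}\<close>, respectively \<open>L\<close> with its edge \<open>{x, y}\<close> subdivided
  by \<open>t\<close>.\<close>

definition "stack_move \<equiv> edge_move {u, t} (Pow {x, y, p}) {x, y, p} v \<Delta>"
definition "cut_move \<equiv> edge_move {u, t} (Pow {x, y, p} \<union> Pow {x, y, q}) {x, y} v \<Delta>"

lemma stack_setup: "edge_move_setup V \<Delta> u t v (Pow {x, y, p}) {x, y, p}"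
proof
  show "u \<notin> \<rho> \<and> t \<notin> \<rho> \<and> insert u (insert t \<rho>) \<in> \<Delta>" if "\<rho> \<in> Pow {x, y, p}" for \<rho>
    using cD(4)[OF facets(1), of "insert u (insert t \<rho>)"] that neqs by blast
  show "card \<rho> \<le> 2" if "\<rho> \<in> Pow {x, y, p}" "\<not> {x, y, p} \<subseteq> \<rho>" for \<rho>
  proof -
    have "card \<rho> < card {x, y, p}"
      using that by (intro psubset_card_mono) auto
    then show ?thesis using neqs by simp
  qed
qed (use full v neqs V in auto)

interpretation st: edge_move_setup V \<Delta> u t v "Pow {x, y, p}" "{x, y, p}"
  by (rule stack_setup)

text \<open>Subdividing \<open>{u, t}\<close> removes this edge, and the flip brings it back. Since
  \<open>{u, t, x, y, p}\<close> is a maximal face, after the subdivision the link of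
  \<open>{v, x, y, p}\<close> consists of the two points \<open>u\<close> and
  \<open>t\<close>.\<close>

lemma pl_sphere_stack: "pl_sphere 4 (insert v V) stack_move"
proof -
  have e: "{u, t} \<in> \<Delta>" "card {u, t} \<noteq> 1"
    using st.pair st.ut by auto
  have pl: "pl_sphere 4 V \<Delta>"
    using full by (simp add: full_edge_def)
  note in_st = in_stellar[OF complex v]
  have fl: "bistellar_flip (insert v V) (stellar {u, t} v \<Delta>) {v, x, y, p} {u, t}"
  proof
    show "abstract_complex (insert v V) (stellar {u, t} v \<Delta>)"
      using abstract_complex_stellar[OF complex e _ v] by simp
    show "{u, t} \<notin> stellar {u, t} v \<Delta>"
      using neqs by (simp add: in_st)
    show "{v, x, y, p} \<union> \<gamma> \<in> stellar {u, t} v \<Delta> \<longleftrightarrow> \<gamma> \<subset> {u, t}" if "\<gamma> \<inter> {v, x, y, p} = {}" for \<gamma>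
    proof -
      have "{v, x, y, p} \<union> \<gamma> - {v} = {x, y, p} \<union> \<gamma>"
        using that neqs by blast
      then have "{v, x, y, p} \<union> \<gamma> \<in> stellar {u, t} v \<Delta> \<longleftrightarrow> \<not> {u, t} \<subseteq> \<gamma> \<and> {x, y, p} \<union> \<gamma> \<union> {u, t} \<in> \<Delta>"
        using neqs by (auto simp: in_st)
      also have "\<dots> \<longleftrightarrow> \<not> {u, t} \<subseteq> \<gamma> \<and> {x, y, p} \<union> \<gamma> \<union> {u, t} = {u, t, x, y, p}"
        using facet_maximal[of "{x, y, p} \<union> \<gamma> \<union> {u, t}"] facets(1) by auto
      also have "\<dots> \<longleftrightarrow> \<gamma> \<subset> {u, t}"
        using that by blast
      finally show ?thesis .
    qed
  qed (use neqs V in auto)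
  have "flip {v, x, y, p} {u, t} (stellar {u, t} v \<Delta>) = stack_move"
  proof (rule set_eqI)
    fix \<sigma>
    show "\<sigma> \<in> flip {v, x, y, p} {u, t} (stellar {u, t} v \<Delta>) \<longleftrightarrow> \<sigma> \<in> stack_move"
    proof (cases "v \<in> \<sigma>")
      case True
      have "\<sigma> \<in> stack_move \<longleftrightarrow> \<not> {x, y, p} \<subseteq> \<sigma> \<and> (if {u, t} \<subseteq> \<sigma> then \<sigma> - {u, t} - {v} \<subseteq> {x, y, p} else \<sigma> - {v} \<union> {u, t} \<in> \<Delta>)"
        using True by (simp add: stack_move_def edge_move_def)
      moreover have "{u, t} \<subseteq> \<sigma> - {v} \<longleftrightarrow> {u, t} \<subseteq> \<sigma>"
        using neqs by auto
      moreover have "{u, t} \<subseteq> \<sigma> \<Longrightarrow> \<sigma> \<subset> {v, x, y, p} \<union> {u, t} \<longleftrightarrow> \<not> {x, y, p} \<subseteq> \<sigma> \<and> \<sigma> - {u, t} - {v} \<subseteq> {x, y, p}"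
        using True by auto
      ultimately show ?thesis
        using True neqs unfolding bistellar_flip.in_flip[OF fl] in_st by auto
    next
      case False
      have "\<sigma> \<in> stack_move \<longleftrightarrow> \<sigma> \<in> \<Delta> \<and> ({u, t} \<subseteq> \<sigma> \<longrightarrow> \<sigma> - {u, t} \<subseteq> {x, y, p})"
        using False by (simp add: stack_move_def edge_move_def)
      moreover have "{u, t} \<subseteq> \<sigma> \<Longrightarrow> \<sigma> \<subset> {v, x, y, p} \<union> {u, t} \<longleftrightarrow> \<sigma> - {u, t} \<subseteq> {x, y, p}"
        using False by auto
      moreover have "\<sigma> - {u, t} \<subseteq> {x, y, p} \<Longrightarrow> \<sigma> \<in> \<Delta>"
        using cD(4)[OF facets(1), of \<sigma>] by blast
      ultimately show ?thesis
        using False unfolding bistellar_flip.in_flip[OF fl] in_st by auto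
    qed
  qed
  moreover have "pl_sphere 4 (insert v V) (stellar {u, t} v \<Delta>)"
    using pl_sphere_stellar[OF pl e _ v] by simp
  ultimately show ?thesis
    using pl_sphere_flip[OF _ fl] by simp
qed

text \<open>A cut is a stack followed by one more flip: after the stack, the link of
  \<open>{v, x, y}\<close> is the boundary of the triangle \<open>{u, t, q}\<close>, which is not a
  face because the stack kept only the triangle \<open>{x, y, p}\<close> around the edge
  \<open>{u, t}\<close>.\<close>

lemma pl_sphere_cut: "pl_sphere 4 (insert v V) cut_move"
proof -
  have stack_complex: "abstract_complex (insert v V) stack_move"
    using pl_sphere_stack by (simp add: pl_sphere_def)
  have fl: "bistellar_flip (insert v V) stack_move {v, x, y} {u, t, q}"
  proof
    show "abstract_complex (insert v V) stack_move"
      by (rule stack_complex)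
    have "{u, t, q} - {u, t} = {q}"
      using neqs by auto
    then show "{u, t, q} \<notin> stack_move"
      using st.old[of "{u, t, q}"] neqs by (simp add: stack_move_def)
    show "{v, x, y} \<union> \<gamma> \<in> stack_move \<longleftrightarrow> \<gamma> \<subset> {u, t, q}" if \<gamma>: "\<gamma> \<inter> {v, x, y} = {}" for \<gamma>
    proof (cases "{u, t} \<subseteq> \<gamma>")
      \<comment> \<open>Faces containing the old edge are governed by the disc, all others by the
        link of the old edge; hence the case distinction.\<close>
      case True
      define \<rho> where "\<rho> = \<gamma> - {u, t}"
      have eq: "{v, x, y} \<union> \<gamma> = insert u (insert v (insert t ({x, y} \<union> \<rho>)))"
        using True by (auto simp: \<rho>_def)
      have "{v, x, y} \<union> \<gamma> \<in> stack_move \<longleftrightarrow> \<not> {x, y, p} \<subseteq> {x, y} \<union> \<rho> \<and> {x, y} \<union> \<rho> \<in> Pow {x, y, p}"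
        unfolding stack_move_def eq using \<gamma> neqs by (intro st.new_edge) (auto simp: \<rho>_def)
      also have "\<dots> \<longleftrightarrow> \<rho> = {}"
        using \<gamma> neqs by (auto simp: \<rho>_def)
      also have "\<dots> \<longleftrightarrow> \<gamma> \<subset> {u, t, q}"
        using True neqs by (auto simp: \<rho>_def)
      finally show ?thesis .
    next
      case False
      have eq: "{v, x, y} \<union> \<gamma> = insert v ({x, y} \<union> \<gamma>)"
        by auto
      have "{v, x, y} \<union> \<gamma> \<in> stack_move \<longleftrightarrow> \<not> {x, y, p} \<subseteq> {x, y} \<union> \<gamma> \<and> insert u (insert t ({x, y} \<union> \<gamma>)) \<in> \<Delta>"
        unfolding stack_move_def eq using \<gamma> neqs False by (intro st.new) auto
      also have "\<dots> \<longleftrightarrow> p \<notin> \<gamma> \<and> insert u (insert t ({x, y} \<union> \<gamma>)) \<in> \<Delta>"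
        using neqs by auto
      also have "\<dots> \<longleftrightarrow> \<gamma> \<subseteq> {u, t, q}"
      proof
        assume *: "p \<notin> \<gamma> \<and> insert u (insert t ({x, y} \<union> \<gamma>)) \<in> \<Delta>"
        show "\<gamma> \<subseteq> {u, t, q}"
        proof
          fix a assume "a \<in> \<gamma>"
          then show "a \<in> {u, t, q}"
            using apex[of a "insert u (insert t ({x, y} \<union> \<gamma>))"] * \<gamma> by auto
        qed
      next
        assume *: "\<gamma> \<subseteq> {u, t, q}"
        then have "insert u (insert t ({x, y} \<union> \<gamma>)) \<subseteq> {u, t, x, y, q}"
          by auto
        then show "p \<notin> \<gamma> \<and> insert u (insert t ({x, y} \<union> \<gamma>)) \<in> \<Delta>"
          using cD(4)[OF facets(2)] * neqs by auto
      qed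
      also have "\<dots> \<longleftrightarrow> \<gamma> \<subset> {u, t, q}"
        using False by auto
      finally show ?thesis .
    qed
  qed (use neqs V in \<open>auto simp: card_insert_if\<close>)
  have "flip {v, x, y} {u, t, q} stack_move = cut_move"
  proof (rule set_eqI)
    fix \<sigma>
    show "\<sigma> \<in> flip {v, x, y} {u, t, q} stack_move \<longleftrightarrow> \<sigma> \<in> cut_move"
    proof (cases "v \<in> \<sigma>")
      case True
      have "\<sigma> \<in> stack_move \<longleftrightarrow> \<not> {x, y, p} \<subseteq> \<sigma> \<and> (if {u, t} \<subseteq> \<sigma> then \<sigma> - {u, t} - {v} \<subseteq> {x, y, p} else \<sigma> - {v} \<union> {u, t} \<in> \<Delta>)"
        using True by (simp add: stack_move_def edge_move_def)
      moreover have "\<sigma> \<in> cut_move \<longleftrightarrow> \<not> {x, y} \<subseteq> \<sigma> \<and>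
          (if {u, t} \<subseteq> \<sigma> then \<sigma> - {u, t} - {v} \<subseteq> {x, y, p} \<or> \<sigma> - {u, t} - {v} \<subseteq> {x, y, q} else \<sigma> - {v} \<union> {u, t} \<in> \<Delta>)"
        using True by (simp add: cut_move_def edge_move_def)
      moreover have "{u, t, q} \<subseteq> \<sigma> \<Longrightarrow>
          \<sigma> \<subset> {v, x, y} \<union> {u, t, q} \<longleftrightarrow> \<not> {x, y} \<subseteq> \<sigma> \<and> \<sigma> - {u, t} - {v} \<subseteq> {x, y, q}"
        using True by auto
      moreover have "q \<notin> \<sigma> \<Longrightarrow> \<sigma> - {u, t} - {v} \<subseteq> {x, y, q} \<Longrightarrow> \<sigma> - {u, t} - {v} \<subseteq> {x, y, p}"
        by auto
      moreover have "q \<in> \<sigma> \<Longrightarrow> \<not> \<sigma> - {u, t} - {v} \<subseteq> {x, y, p}"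
        using neqs by auto
      ultimately show ?thesis
        using True unfolding bistellar_flip.in_flip[OF fl] by auto
    next
      case False
      have "\<sigma> \<in> stack_move \<longleftrightarrow> \<sigma> \<in> \<Delta> \<and> ({u, t} \<subseteq> \<sigma> \<longrightarrow> \<sigma> - {u, t} \<subseteq> {x, y, p})"
        using False by (simp add: stack_move_def edge_move_def)
      moreover have "\<sigma> \<in> cut_move \<longleftrightarrow> \<sigma> \<in> \<Delta> \<and> ({u, t} \<subseteq> \<sigma> \<longrightarrow> \<sigma> - {u, t} \<subseteq> {x, y, p} \<or> \<sigma> - {u, t} \<subseteq> {x, y, q})"
        using False by (simp add: cut_move_def edge_move_def)
      moreover have "{u, t, q} \<subseteq> \<sigma> \<Longrightarrow> \<sigma> \<subset> {v, x, y} \<union> {u, t, q} \<longleftrightarrow> \<sigma> - {u, t} \<subseteq> {x, y, q}"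
        using False by auto
      moreover have "\<sigma> - {u, t} \<subseteq> {x, y, q} \<Longrightarrow> \<sigma> \<in> \<Delta>"
        using cD(4)[OF facets(2), of \<sigma>] by blast
      moreover have "q \<notin> \<sigma> \<Longrightarrow> \<sigma> - {u, t} \<subseteq> {x, y, q} \<Longrightarrow> \<sigma> - {u, t} \<subseteq> {x, y, p}"
        by auto
      ultimately show ?thesis
        using False unfolding bistellar_flip.in_flip[OF fl] by auto
    qed
  qed
  then show ?thesis
    using pl_sphere_flip[OF pl_sphere_stack fl] by simp
qed

text \<open>The stacked triangle leaves the link while its edges stay, so it becomes missing; no
  other three-element set contains it.\<close>

lemma link_missing_stack: "link_missing stack_move u v = insert {x, y, p} (link_missing \<Delta> u t)"
proof -
  have 3: "\<not> {x, y, p} \<subseteq> {a, b}" for a b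
    using neqs by auto
  have eq: "\<tau> = T" if "\<tau> \<subseteq> T" "card T = 3" "card \<tau> = 3" for \<tau> T :: "nat set"
    using that card_subset_eq[of T \<tau>] by (metis card.infinite zero_neq_numeral)
  have \<tau>: "{x, y, p} \<in> \<Delta>" "card {x, y, p} = 3"
    using cD(4)[OF facets(1), of "{x, y, p}"] neqs by auto
  have "{u, t, a, b} \<in> \<Delta>" if "a \<in> {x, y, p}" "b \<in> {x, y, p}" for a b
    using cD(4)[OF facets(1), of "{u, t, a, b}"] that by blast
  moreover have "{x, y, p} \<subseteq> T \<longleftrightarrow> T = {x, y, p}" if "card T = 3" for T
    using eq[of "{x, y, p}" T] that \<tau> by auto
  ultimately show ?thesis
    unfolding stack_move_def st.link_missing_move unfolding link_missing_def using \<tau> 3 neqs by auto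
qed

text \<open>The edge \<open>{x, y}\<close> survives, with \<open>t\<close> in place of
  \<open>p\<close> as an opposite vertex, so it can be stacked or cut again.\<close>

lemma link_edge_stack: "link_edge stack_move u v x y t q"
proof -
  have "{u, v, x, y, a} \<in> stack_move \<longleftrightarrow> a = t \<or> a = q" if "a \<notin> {u, v, x, y}" for a
  proof (cases "a = t")
    case True
    have "insert u (insert v (insert t {x, y})) \<in> stack_move"
      unfolding stack_move_def by (subst st.new_edge) (use neqs in auto)
    moreover have "insert u (insert v (insert t {x, y})) = {u, v, x, y, a}"
      using True by auto
    ultimately show ?thesis using True by simp
  next
    case False
    have "insert v {u, x, y, a} \<in> stack_move \<longleftrightarrow> \<not> {x, y, p} \<subseteq> {u, x, y, a} \<and> insert u (insert t {u, x, y, a}) \<in> \<Delta>"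
      unfolding stack_move_def using neqs that False by (intro st.new) auto
    moreover have "insert v {u, x, y, a} = {u, v, x, y, a}" "insert u (insert t {u, x, y, a}) = {u, t, x, y, a}"
      by auto
    ultimately have "{u, v, x, y, a} \<in> stack_move \<longleftrightarrow> a \<noteq> p \<and> {u, t, x, y, a} \<in> \<Delta>"
      using neqs by auto
    also have "\<dots> \<longleftrightarrow> a = q"
      using le that False neqs by (auto simp: link_edge_def)
    finally show ?thesis using False by simp
  qed
  then show ?thesis
    using neqs by (auto simp: link_edge_def)
qed

text \<open>This non-adjacency of the opposite vertices is what a subsequent cut of
  \<open>{x, y}\<close> requires.\<close>

lemma link_nonedge_stack: "{u, v, t, q} \<notin> stack_move"
proof -
  have "insert u (insert v (insert t {q})) \<notin> stack_move"
    unfolding stack_move_def by (subst st.new_edge) (use neqs in auto)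
  then show ?thesis by simp
qed

context
  assumes nonedge: "{u, t, p, q} \<notin> \<Delta>"
begin

lemma cut_setup: "edge_move_setup V \<Delta> u t v (Pow {x, y, p} \<union> Pow {x, y, q}) {x, y}"
proof
  show "u \<notin> \<rho> \<and> t \<notin> \<rho> \<and> insert u (insert t \<rho>) \<in> \<Delta>" if "\<rho> \<in> Pow {x, y, p} \<union> Pow {x, y, q}" for \<rho>
    using cD(4)[OF facets(1), of "insert u (insert t \<rho>)"]
      cD(4)[OF facets(2), of "insert u (insert t \<rho>)"] that neqs by blast
  show "card \<rho> \<le> 2" if "\<rho> \<in> Pow {x, y, p} \<union> Pow {x, y, q}" "\<not> {x, y} \<subseteq> \<rho>" for \<rho>
  proof -
    have "\<rho> \<subseteq> {x, p} \<or> \<rho> \<subseteq> {y, p} \<or> \<rho> \<subseteq> {x, q} \<or> \<rho> \<subseteq> {y, q}"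
      using that by blast
    moreover have "card {a, b} \<le> 2" for a b :: nat
      by (simp add: card_insert_if)
    ultimately show ?thesis
      by (meson card_mono finite.emptyI finite_insert le_trans)
  qed
  show "{a, b} \<in> Pow {x, y, p} \<union> Pow {x, y, q}"
    if "{a} \<in> Pow {x, y, p} \<union> Pow {x, y, q}" "{b} \<in> Pow {x, y, p} \<union> Pow {x, y, q}" "{u, t, a, b} \<in> \<Delta>" for a b
    using that nonedge by (auto simp: insert_commute)
qed (use full v neqs V in auto)

interpretation cu: edge_move_setup V \<Delta> u t v "Pow {x, y, p} \<union> Pow {x, y, q}" "{x, y}"
  by (rule cut_setup)

text \<open>Missing triangles through \<open>{x, y}\<close> lose an edge and disappear. None are
  created, since a destroyed triangle contains \<open>{x, y}\<close> too.\<close>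

lemma link_missing_cut: "link_missing cut_move u v = {T \<in> link_missing \<Delta> u t. \<not> {x, y} \<subseteq> T}"
  unfolding cut_move_def cu.link_missing_move unfolding link_missing_def by blast

text \<open>One half of the subdivided edge has the same opposite vertices \<open>p\<close> and
  \<open>q\<close>, which remain non-adjacent; cuts can therefore be repeated.\<close>

lemma link_edge_cut: "link_edge cut_move u v x t p q"
proof -
  have "{u, v, x, t, a} \<in> cut_move \<longleftrightarrow> a = p \<or> a = q" if "a \<notin> {u, v, x, t}" for a
  proof -
    have "insert u (insert v (insert t {x, a})) \<in> cut_move \<longleftrightarrow> \<not> {x, y} \<subseteq> {x, a} \<and> {x, a} \<in> Pow {x, y, p} \<union> Pow {x, y, q}"
      unfolding cut_move_def using that neqs by (intro cu.new_edge) auto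
    moreover have "insert u (insert v (insert t {x, a})) = {u, v, x, t, a}"
      by auto
    ultimately show ?thesis
      using neqs that by auto
  qed
  then show ?thesis
    using neqs by (auto simp: link_edge_def)
qed

lemma link_nonedge_cut: "{u, v, p, q} \<notin> cut_move"
  unfolding cut_move_def using nonedge neqs by (intro cu.link_nonedge_move) auto

end

end

section \<open>Counting missing faces\<close>

text \<open>\<open>c\<close> and \<open>b\<close> count the missing triangles of the link of \<open>{u, t}\<close> through the edges
  \<open>{x, y}\<close> and \<open>{z, w}\<close>; the flag of an edge promises that the two vertices opposite to
  it in this link are not adjacent there.\<close>

definition state :: "nat \<Rightarrow> nat \<Rightarrow> nat \<Rightarrow> nat \<Rightarrow> bool \<Rightarrow> bool \<Rightarrow> bool" where
  "state n m c b oc ob \<longleftrightarrow> (\<exists>(V :: nat set) \<Delta> u t x y p q z w p' q' A B.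
     full_edge V \<Delta> u t \<and> card V = n \<and> num_missing_faces 3 V \<Delta> = m \<and>
     (\<forall>F\<in>missing_faces 3 V \<Delta>. \<not> {u, t} \<subseteq> F) \<and>
     link_edge \<Delta> u t x y p q \<and> link_edge \<Delta> u t z w p' q' \<and> {x, y} \<inter> {z, w} = {} \<and>
     (oc \<longrightarrow> {u, t, p, q} \<notin> \<Delta>) \<and> (ob \<longrightarrow> {u, t, p', q'} \<notin> \<Delta>) \<and>
     link_missing \<Delta> u t = A \<union> B \<and> (\<forall>T\<in>A. {x, y} \<subseteq> T) \<and> (\<forall>T\<in>B. {z, w} \<subseteq> T) \<and>
     card A = c \<and> card B = b)"

lemma stateI:
  fixes V :: "nat set"
  assumes
     "full_edge V \<Delta> u t" "card V = n" "num_missing_faces 3 V \<Delta> = m"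
     "\<forall>F\<in>missing_faces 3 V \<Delta>. \<not> {u, t} \<subseteq> F"
     "link_edge \<Delta> u t x y p q" "link_edge \<Delta> u t z w p' q'" "{x, y} \<inter> {z, w} = {}"
     "oc \<longrightarrow> {u, t, p, q} \<notin> \<Delta>" "ob \<longrightarrow> {u, t, p', q'} \<notin> \<Delta>"
     "link_missing \<Delta> u t = A \<union> B" "\<forall>T\<in>A. {x, y} \<subseteq> T" "\<forall>T\<in>B. {z, w} \<subseteq> T"
     "card A = c" "card B = b"
  shows "state n m c b oc ob"
  unfolding state_def using assms by (intro exI conjI)

lemma stateE:
  assumes "state n m c b oc ob"
  obtains V :: "nat set" and \<Delta> u t x y p q z w p' q' A B where
     "full_edge V \<Delta> u t" "card V = n" "num_missing_faces 3 V \<Delta> = m"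
     "\<forall>F\<in>missing_faces 3 V \<Delta>. \<not> {u, t} \<subseteq> F"
     "link_edge \<Delta> u t x y p q" "link_edge \<Delta> u t z w p' q'" "{x, y} \<inter> {z, w} = {}"
     "oc \<longrightarrow> {u, t, p, q} \<notin> \<Delta>" "ob \<longrightarrow> {u, t, p', q'} \<notin> \<Delta>"
     "link_missing \<Delta> u t = A \<union> B" "\<forall>T\<in>A. {x, y} \<subseteq> T" "\<forall>T\<in>B. {z, w} \<subseteq> T"
     "card A = c" "card B = b"
  using assms unfolding state_def by (elim exE conjE) (rule that)

lemma state_swap:
  assumes "state n m c b oc ob"
  shows "state n m b c ob oc"
  using assms
proof (rule stateE)
  fix V :: "nat set" and \<Delta> u t x y p q z w p' q' A B
  assume *:
     "full_edge V \<Delta> u t" "card V = n" "num_missing_faces 3 V \<Delta> = m"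
     "\<forall>F\<in>missing_faces 3 V \<Delta>. \<not> {u, t} \<subseteq> F"
     "link_edge \<Delta> u t x y p q" "link_edge \<Delta> u t z w p' q'" "{x, y} \<inter> {z, w} = {}"
     "oc \<longrightarrow> {u, t, p, q} \<notin> \<Delta>" "ob \<longrightarrow> {u, t, p', q'} \<notin> \<Delta>"
     "link_missing \<Delta> u t = A \<union> B" "\<forall>T\<in>A. {x, y} \<subseteq> T" "\<forall>T\<in>B. {z, w} \<subseteq> T"
     "card A = c" "card B = b"
  show ?thesis
    by (rule stateI[OF *(1-4,6,5) _ *(9,8) _ *(12,11,14,13)]) (use *(7,10) in blast)+
qed

lemma link_missing_card: "T \<in> link_missing \<Delta> u t \<Longrightarrow> card T = 3"
  by (simp add: link_missing_def)

text \<open>Hence no missing triangle is counted at both tracked edges, and a cut at one edge spares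
  the triangles at the other.\<close>

lemma disjoint_edges_card:
  assumes "card T = 3" "x \<noteq> y" "z \<noteq> w" "{x, y} \<inter> {z, w} = {}" "{x, y} \<subseteq> T" "{z, w} \<subseteq> T"
  shows False
proof -
  have "card {x, y, z, w} \<le> card T"
    using assms by (intro card_mono) (auto intro: card_ge_0_finite)
  moreover have "card {x, y, z, w} = 4"
    using assms by auto
  ultimately show False
    using assms(1) by simp
qed

section \<open>Effect of the moves on the counts\<close>

text \<open>The new link has \<open>b + c + 1\<close> missing triangles, the stacked one being added
  at the first edge. Each of them spans a missing 3-face with the new vertex.\<close>

lemma state_stack:
  assumes "state n m c b oc ob"
  shows "state (n + 1) (m + b + c + 1) (c + 1) b True ob"
proof -
  obtain V :: "nat set" and \<Delta> u t x y p q z w p' q' A B where *: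
     "full_edge V \<Delta> u t" "card V = n" "num_missing_faces 3 V \<Delta> = m"
     and miss: "\<forall>F\<in>missing_faces 3 V \<Delta>. \<not> {u, t} \<subseteq> F"
     and le: "link_edge \<Delta> u t x y p q" "link_edge \<Delta> u t z w p' q'" and disj: "{x, y} \<inter> {z, w} = {}"
     and nonedge: "ob \<longrightarrow> {u, t, p', q'} \<notin> \<Delta>"
     and lm: "link_missing \<Delta> u t = A \<union> B" "\<forall>T\<in>A. {x, y} \<subseteq> T" "\<forall>T\<in>B. {z, w} \<subseteq> T"
     "card A = c" "card B = b"
    using assms by (rule stateE)
  have "abstract_complex V \<Delta>"
    using *(1) by (simp add: full_edge_def pl_sphere_def)
  note cD = abstract_complexD[OF this]
  obtain v where v: "v \<notin> V"
    using cD(1) ex_new_if_finite infinite_UNIV_nat by blast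
  interpret E: full_link_edge V \<Delta> u t x y p q v
    using * le v by unfold_locales
  interpret Z: full_link_edge V \<Delta> u t z w p' q' v
    using * le v by unfold_locales
  interpret st: edge_move_setup V \<Delta> u t v "Pow {x, y, p}" "{x, y, p}"
    by (rule E.stack_setup)
  have fin: "finite A" "finite B"
    using lm(1) cD(7) by (auto simp: link_missing_def intro: finite_subset[of _ \<Delta>])
  have AB: "A \<inter> B = {}"
  proof -
    have False if "T \<in> A" "T \<in> B" for T
      using that lm(1-3) by (intro disjoint_edges_card[OF link_missing_card E.neq(12) Z.neq(12) disj, of T]) auto
    then show ?thesis by blast
  qed
  have "{x, y, p} \<notin> link_missing \<Delta> u t"
    using E.facets(1) by (auto simp: link_missing_def)
  then have \<tau>: "{x, y, p} \<notin> A" "{x, y, p} \<notin> A \<union> B"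
    using lm(1) by auto
  note unkept = st.num_missing_faces_move[folded E.stack_move_def]
  have "{F \<in> missing_faces 3 V \<Delta>. \<not> {u, t} \<subseteq> F} = missing_faces 3 V \<Delta>"
    using miss by blast
  then have "card {F \<in> missing_faces 3 V \<Delta>. \<not> {u, t} \<subseteq> F} = m"
    using *(3) by (simp add: num_missing_faces_def)
  moreover have "card (link_missing E.stack_move u v) = c + b + 1"
    using \<tau> fin AB lm by (simp add: E.link_missing_stack card_Un_disjoint)
  ultimately have num: "num_missing_faces 3 (insert v V) E.stack_move = m + b + c + 1"
    using unkept(1) miss by auto
  have miss': "\<forall>F\<in>missing_faces 3 (insert v V) E.stack_move. \<not> {u, v} \<subseteq> F"
    using unkept(2) miss by blast
  have full': "full_edge (insert v V) E.stack_move u v"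
    using st.full_edge_move E.pl_sphere_stack by (simp add: E.stack_move_def)
  have zw: "link_edge E.stack_move u v z w p' q'"
    unfolding E.stack_move_def
    using disj E.neqs Z.neqs le(2) by (intro st.link_edge_move) auto
  have nonedge': "ob \<longrightarrow> {u, v, p', q'} \<notin> E.stack_move"
    unfolding E.stack_move_def using nonedge Z.neqs st.link_nonedge_move[of p' q'] by auto
  have "card (insert v V) = n + 1"
    using * v cD(1) by simp
  moreover have "link_missing E.stack_move u v = insert {x, y, p} A \<union> B"
    using lm by (simp add: E.link_missing_stack)
  moreover have "card (insert {x, y, p} A) = c + 1"
    using \<tau> fin lm by simp
  moreover have "\<forall>T\<in>insert {x, y, p} A. {x, y} \<subseteq> T"
    using lm by auto
  ultimately show ?thesis
    using E.link_nonedge_stack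
    by (intro stateI[OF full' _ num miss' E.link_edge_stack zw disj _ nonedge' _ _ lm(3) _ lm(5)]) auto
qed

text \<open>Missing 3-faces through \<open>{u, t}\<close> are allowed here if they have a vertex
  outside the two triangles of the disc; they are destroyed by the cut and left out of
  \<open>m\<close>. The new missing 3-faces come from the \<open>b\<close> triangles at the second
  edge.\<close>

lemma state_cut_general:
  fixes V :: "nat set"
  assumes full: "full_edge V \<Delta> u t" and n: "card V = n"
     and m: "card {F \<in> missing_faces 3 V \<Delta>. \<not> {u, t} \<subseteq> F} = m"
     and miss: "\<And>F. F \<in> missing_faces 3 V \<Delta> \<Longrightarrow> u \<in> F \<Longrightarrow> t \<in> F \<Longrightarrow> \<not> F \<subseteq> {u, t, x, y, p, q}"
     and le: "link_edge \<Delta> u t x y p q" "link_edge \<Delta> u t z w p' q'" and disj: "{x, y} \<inter> {z, w} = {}"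
     and nonedge: "{u, t, p, q} \<notin> \<Delta>" "ob \<longrightarrow> {u, t, p', q'} \<notin> \<Delta>"
     and lm: "link_missing \<Delta> u t = A \<union> B" "\<forall>T\<in>A. {x, y} \<subseteq> T" "\<forall>T\<in>B. {z, w} \<subseteq> T" "card B = b"
  shows "state (n + 1) (m + b) 0 b True ob"
proof -
  have "abstract_complex V \<Delta>"
    using full by (simp add: full_edge_def pl_sphere_def)
  note cD = abstract_complexD[OF this]
  obtain v where v: "v \<notin> V"
    using cD(1) ex_new_if_finite infinite_UNIV_nat by blast
  interpret E: full_link_edge V \<Delta> u t x y p q v
    using full le v by unfold_locales
  interpret Z: full_link_edge V \<Delta> u t z w p' q' v
    using full le v by unfold_locales
  interpret st: edge_move_setup V \<Delta> u t v "Pow {x, y, p} \<union> Pow {x, y, q}" "{x, y}"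
    by (rule E.cut_setup[OF nonedge(1)])
  have lm': "link_missing E.cut_move u v = B"
  proof -
    have "\<not> {x, y} \<subseteq> T" if "T \<in> B" for T
      using that lm(1,3) disjoint_edges_card[OF link_missing_card[of T \<Delta> u t] E.neq(12) Z.neq(12) disj] by auto
    then show ?thesis
      unfolding E.link_missing_cut[OF nonedge(1)] lm(1) using lm(2) by auto
  qed
  have kept: "\<exists>a\<in>F - {u, t}. {a} \<notin> Pow {x, y, p} \<union> Pow {x, y, q}"
    if "F \<in> missing_faces 3 V \<Delta>" "u \<in> F" "t \<in> F" for F
    using miss[OF that] by auto
  note unkept = st.num_missing_faces_move[folded E.cut_move_def, OF kept]
  have num: "num_missing_faces 3 (insert v V) E.cut_move = m + b"
    using unkept(1) m lm' lm(4) by auto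
  have miss': "\<forall>F\<in>missing_faces 3 (insert v V) E.cut_move. \<not> {u, v} \<subseteq> F"
    using unkept(2) by blast
  have full': "full_edge (insert v V) E.cut_move u v"
    using st.full_edge_move E.pl_sphere_cut by (simp add: E.cut_move_def)
  have zw: "link_edge E.cut_move u v z w p' q'"
    unfolding E.cut_move_def
    using disj E.neqs Z.neqs le(2) by (intro st.link_edge_move) auto
  have nonedge': "ob \<longrightarrow> {u, v, p', q'} \<notin> E.cut_move"
    unfolding E.cut_move_def using nonedge Z.neqs st.link_nonedge_move[of p' q'] by auto
  have "card (insert v V) = n + 1"
    using n v cD(1) by simp
  moreover have "link_missing E.cut_move u v = {} \<union> B" "\<forall>T\<in>{} :: nat set set. {x, t} \<subseteq> T"
    using lm' by auto
  moreover have "{x, t} \<inter> {z, w} = {}"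
    using disj Z.neqs by auto
  ultimately show ?thesis
    using E.link_nonedge_cut[OF nonedge(1)]
    by (intro stateI[where A = "{}", OF full' _ num miss' E.link_edge_cut[OF nonedge(1)] zw _ _ nonedge' _ _ lm(3) _ lm(4)])
      auto
qed

lemma state_cut:
  assumes "state n m c b True ob"
  shows "state (n + 1) (m + b) 0 b True ob"
proof -
  obtain V :: "nat set" and \<Delta> u t x y p q z w p' q' A B where *:
     "full_edge V \<Delta> u t" "card V = n" "num_missing_faces 3 V \<Delta> = m"
     and miss: "\<forall>F\<in>missing_faces 3 V \<Delta>. \<not> {u, t} \<subseteq> F"
     and le: "link_edge \<Delta> u t x y p q" "link_edge \<Delta> u t z w p' q'" and disj: "{x, y} \<inter> {z, w} = {}"
     and nonedge: "{u, t, p, q} \<notin> \<Delta>" "ob \<longrightarrow> {u, t, p', q'} \<notin> \<Delta>"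
     and lm: "link_missing \<Delta> u t = A \<union> B" "\<forall>T\<in>A. {x, y} \<subseteq> T" "\<forall>T\<in>B. {z, w} \<subseteq> T"
     "card A = c" "card B = b"
    using assms by (rule stateE) (rule that; simp)
  have "{F \<in> missing_faces 3 V \<Delta>. \<not> {u, t} \<subseteq> F} = missing_faces 3 V \<Delta>"
    using miss by blast
  then show ?thesis
    using * miss le disj nonedge lm(1-3,5)
    by (intro state_cut_general[of V \<Delta> u t n m x y p q z w p' q' ob A B b])
       (auto simp: num_missing_faces_def)
qed

section \<open>Two starting spheres, with 6 and with 9 vertices\<close>

lemma atMost_5: "{..5 :: nat} = {0, 1, 2, 3, 4, 5}"
  by (simp add: atMost_nat_numeral) auto

lemma full_edge_simplex_boundary: "full_edge {..5} (simplex_boundary 4) 0 1"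
  unfolding full_edge_def
proof (intro conjI ballI)
  have sb: "simplex_boundary 4 = {\<sigma>. \<sigma> \<subset> {..5}}"
    by (simp add: simplex_boundary_def)
  have fin: "finite \<sigma>" if "\<sigma> \<subset> {..5 :: nat}" for \<sigma>
    using that finite_subset by blast
  have small: "\<sigma> \<subset> {..5 :: nat}" if "\<sigma> \<subseteq> {..5}" "card \<sigma> < 6" for \<sigma>
    using that by auto
  have "finite (simplex_boundary 4)"
    unfolding sb by (rule finite_subset[of _ "Pow {..5}"]) auto
  then have "pl_homeomorphic (realization (simplex_boundary 4)) (realization (simplex_boundary 4))"
    by (rule pl_homeomorphic_refl) (auto simp: sb fin)
  moreover have "{v} \<in> simplex_boundary 4" if "v \<in> {..5}" for v
    using small[of "{v}"] that by (simp add: sb)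
  then have "abstract_complex {..5} (simplex_boundary 4)"
    unfolding abstract_complex_def by (auto simp: sb)
  ultimately show "pl_sphere 4 {..5} (simplex_boundary 4)"
    by (simp add: pl_sphere_def)
  show "card \<sigma> \<le> 5" if "\<sigma> \<in> simplex_boundary 4" for \<sigma>
    using psubset_card_mono[of "{..5}" \<sigma>] that by (simp add: sb)
  show "{a, b} \<in> simplex_boundary 4" if "a \<in> {..5}" "b \<in> {..5}" for a b
    using small[of "{a, b}"] that by (simp add: sb card_insert_if)
  show "{0, 1, a} \<in> simplex_boundary 4" if "a \<in> {..5}" for a
    using small[of "{0, 1, a}"] that by (simp add: sb card_insert_if)
qed auto

lemma in_simplex_boundary_4: "\<sigma> \<in> simplex_boundary 4 \<longleftrightarrow> \<sigma> \<subset> {0, 1, 2, 3, 4, 5}"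
  by (simp add: simplex_boundary_def atMost_5)

lemma link_edge_simplex_boundary:
  assumes "distinct [0, 1, x, y, p, q]" "{0, 1, x, y, p, q} = {..5}"
  shows "link_edge (simplex_boundary 4) 0 1 x y p q"
proof -
  have "{0, 1, x, y, a} \<subset> {0, 1, x, y, p, q} \<longleftrightarrow> a = p \<or> a = q" if "a \<notin> {0, 1, x, y}" for a
  proof (intro iffI)
    assume "a = p \<or> a = q"
    moreover have "q \<notin> {0, 1, x, y, p}" "p \<notin> {0, 1, x, y, q}"
      using assms(1) by auto
    ultimately show "{0, 1, x, y, a} \<subset> {0, 1, x, y, p, q}"
      by blast
  qed (use that in blast)
  then have "\<forall>a. a \<notin> {0, 1, x, y} \<longrightarrow> {0, 1, x, y, a} \<in> simplex_boundary 4 \<longleftrightarrow> a = p \<or> a = q"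
    unfolding assms(2) by (simp add: simplex_boundary_def)
  then show ?thesis
    using assms(1) unfolding link_edge_def by blast
qed

lemma state_start: "state 6 0 0 0 False False"
proof -
  let ?\<Delta> = "simplex_boundary 4"
  have "F \<notin> missing_faces 3 {..5} ?\<Delta>" for F
    by (auto simp: missing_faces_def simplex_boundary_def)
  then have "missing_faces 3 {..5} ?\<Delta> = {}"
    by blast
  moreover have "T \<notin> link_missing ?\<Delta> 0 1" for T
  proof
    assume "T \<in> link_missing ?\<Delta> 0 1"
    then have T: "T \<subset> {..5}" "card T = 3" "\<not> {0, 1} \<union> T \<subset> {..5}"
      by (auto simp: link_missing_def simplex_boundary_def)
    then have "{0, 1} \<union> T = {..5}"
      by auto
    moreover have "card ({0, 1} \<union> T) \<le> card {0, 1 :: nat} + card T"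
      by (rule card_Un_le)
    ultimately show False
      using T(2) by simp
  qed
  then have "link_missing ?\<Delta> 0 1 = {} \<union> {}"
    by blast
  \<comment> \<open>The link of \<open>{0, 1}\<close> is the boundary of the tetrahedron on 2, 3, 4,
    5. Two opposite edges are tracked; the vertices opposite to one are the ends of the other and
    thus adjacent, so both flags are false.\<close>
  moreover have "link_edge ?\<Delta> 0 1 2 3 4 5" "link_edge ?\<Delta> 0 1 4 5 2 3"
    by (rule link_edge_simplex_boundary; auto)+
  ultimately show ?thesis
    using full_edge_simplex_boundary
    by (intro stateI[of "{..5}" ?\<Delta> 0 1 6 0 2 3 4 5 4 5 2 3 False False "{}" "{}"])
      (auto simp: num_missing_faces_def)
qed

text \<open>The moves along one edge, starting from the boundary of the simplex, always leave a missing
  3-face. Stacking and cutting once leads to the following sphere with the single missing 3-face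
  \<open>{2, 3, 4, 6}\<close>, and a cut at its edge \<open>{2, 4}\<close> destroys that one.\<close>

definition nonfaces_8 :: "nat set set" where
  "nonfaces_8 = {{0, 1, 5}, {0, 4, 6}, {1, 5, 7}, {2, 3, 7}, {2, 3, 4, 6}}"

definition sphere_8 :: "nat set set" where
  "sphere_8 = {\<sigma>. \<sigma> \<subseteq> {0, 1, 2, 3, 4, 5, 6, 7} \<and> (\<forall>N\<in>nonfaces_8. \<not> N \<subseteq> \<sigma>)}"

text \<open>The moves are a stack on the triangle \<open>{2, 3, 4}\<close> along the edge
  \<open>{0, 1}\<close>, with new vertex 6, and then a cut of \<open>{2, 3}\<close> along the edge
  \<open>{0, 6}\<close>, with new vertex 7. The rest identifies the result by its minimal
  nonfaces.\<close>

lemma pl_sphere_8: "pl_sphere 4 {0, 1, 2, 3, 4, 5, 6, 7} sphere_8" (is ?pl)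
  and card_sphere_8: "\<sigma> \<in> sphere_8 \<Longrightarrow> card \<sigma> \<le> 5"
proof -
  have le6: "link_edge (simplex_boundary 4) 0 1 2 3 4 5"
    by (rule link_edge_simplex_boundary) (auto simp: atMost_5)
  interpret D6: full_link_edge "{..5}" "simplex_boundary 4" 0 1 2 3 4 5 6
    using full_edge_simplex_boundary le6 by unfold_locales auto
  interpret S6: edge_move_setup "{..5}" "simplex_boundary 4" 0 1 6 "Pow {2, 3, 4}" "{2, 3, 4}"
    by (rule D6.stack_setup)
  have full7: "full_edge (insert 6 {..5}) D6.stack_move 0 6"
    using S6.full_edge_move[folded D6.stack_move_def] D6.pl_sphere_stack by blast
  interpret D7: full_link_edge "insert 6 {..5}" D6.stack_move 0 6 2 3 1 5 7
    using full7 D6.link_edge_stack by unfold_locales auto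
  interpret S7: edge_move_setup "insert 6 {..5}" D6.stack_move 0 6 7 "Pow {2, 3, 1} \<union> Pow {2, 3, 5}" "{2, 3}"
    by (rule D7.cut_setup[OF D6.link_nonedge_stack])
  have full8: "full_edge (insert 7 (insert 6 {..5})) D7.cut_move 0 7"
    using S7.full_edge_move[folded D7.cut_move_def] D7.pl_sphere_cut by blast
  have D7: "\<sigma> \<in> D6.stack_move \<longleftrightarrow> \<sigma> \<subseteq> {0, 1, 2, 3, 4, 5, 6} \<and> \<not> {0, 1, 5} \<subseteq> \<sigma> \<and> \<not> {2, 3, 4, 6} \<subseteq> \<sigma>" for \<sigma>
  proof -
    \<comment> \<open>Hiding the range condition in \<open>P\<close> leaves a propositional
      statement about which of the finitely many vertices lie in \<open>\<sigma>\<close>.\<close>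
    define P where "P \<longleftrightarrow> \<sigma> \<subseteq> {0, 1, 2, 3, 4, 5, 6}"
    show ?thesis
    proof (cases "6 \<in> \<sigma>")
      case True
      have 1: "\<sigma> - {0, 1} - {6} \<subseteq> {2, 3, 4} \<longleftrightarrow> P \<and> 5 \<notin> \<sigma>"
        unfolding P_def by auto
      have "\<sigma> - {6} \<union> {0, 1} \<subseteq> {0, 1, 2, 3, 4, 5} \<longleftrightarrow> P"
        unfolding P_def by auto
      moreover have "{0, 1, 2, 3, 4, 5} \<subseteq> \<sigma> - {6} \<union> {0, 1} \<longleftrightarrow> {2, 3, 4, 5} \<subseteq> \<sigma>"
        by simp
      ultimately have 2: "\<sigma> - {6} \<union> {0, 1} \<subset> {0, 1, 2, 3, 4, 5} \<longleftrightarrow> P \<and> \<not> {2, 3, 4, 5} \<subseteq> \<sigma>"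
        by (simp only: less_le_not_le)
      show ?thesis
        using True unfolding D6.stack_move_def edge_move_def in_simplex_boundary_4 mem_Collect_eq
          Pow_iff 1 2 P_def[symmetric] by auto
    next
      case False
      then have 1: "\<sigma> \<subseteq> {0, 1, 2, 3, 4, 5} \<longleftrightarrow> P"
        unfolding P_def by auto
      then have 2: "\<sigma> \<subset> {0, 1, 2, 3, 4, 5} \<longleftrightarrow> P \<and> \<not> {0, 1, 2, 3, 4, 5} \<subseteq> \<sigma>"
        by (simp only: less_le_not_le)
      have 3: "\<sigma> - {0, 1} \<subseteq> {2, 3, 4} \<longleftrightarrow> P \<and> 5 \<notin> \<sigma>"
        unfolding 1[symmetric] by auto
      show ?thesis
        using False unfolding D6.stack_move_def edge_move_def in_simplex_boundary_4 mem_Collect_eq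
          Pow_iff 2 3 P_def[symmetric] by auto
    qed
  qed
  have "\<sigma> \<in> D7.cut_move \<longleftrightarrow> \<sigma> \<in> sphere_8" for \<sigma>
  proof -
    define P where "P \<longleftrightarrow> \<sigma> \<subseteq> {0, 1, 2, 3, 4, 5, 6, 7}"
    show ?thesis
    proof (cases "7 \<in> \<sigma>")
      case True
      have 1: "\<sigma> - {0, 6} - {7} \<subseteq> {2, 3, 1} \<longleftrightarrow> P \<and> 4 \<notin> \<sigma> \<and> 5 \<notin> \<sigma>"
        "\<sigma> - {0, 6} - {7} \<subseteq> {2, 3, 5} \<longleftrightarrow> P \<and> 1 \<notin> \<sigma> \<and> 4 \<notin> \<sigma>"
        unfolding P_def by auto
      have 2: "\<sigma> - {7} \<union> {0, 6} \<subseteq> {0, 1, 2, 3, 4, 5, 6} \<longleftrightarrow> P"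
        unfolding P_def by auto
      show ?thesis
        using True unfolding D7.cut_move_def edge_move_def D7 mem_Collect_eq Un_iff Pow_iff
          sphere_8_def nonfaces_8_def 1 2 P_def[symmetric] by auto
    next
      case False
      then have 1: "\<sigma> \<subseteq> {0, 1, 2, 3, 4, 5, 6} \<longleftrightarrow> P"
        unfolding P_def by auto
      have 2: "\<sigma> - {0, 6} \<subseteq> {2, 3, 1} \<longleftrightarrow> P \<and> 4 \<notin> \<sigma> \<and> 5 \<notin> \<sigma>"
        "\<sigma> - {0, 6} \<subseteq> {2, 3, 5} \<longleftrightarrow> P \<and> 1 \<notin> \<sigma> \<and> 4 \<notin> \<sigma>"
        unfolding 1[symmetric] by auto
      show ?thesis
        using False unfolding D7.cut_move_def edge_move_def D7 mem_Collect_eq Un_iff Pow_iff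
          sphere_8_def nonfaces_8_def 1 2 P_def[symmetric] by auto
    qed
  qed
  then have eq: "D7.cut_move = sphere_8"
    by blast
  have V: "insert 7 (insert 6 {..5}) = {0, 1, 2, 3, 4, 5, 6, 7 :: nat}"
    unfolding atMost_5 by auto
  show ?pl "\<sigma> \<in> sphere_8 \<Longrightarrow> card \<sigma> \<le> 5"
    using full8 unfolding full_edge_def eq V by auto
qed

text \<open>The move goes along \<open>{2, 4}\<close> and cuts the edge \<open>{0, 1}\<close> of its
  link, whose opposite vertices 3 and 7 are not adjacent there because of the nonface
  \<open>{2, 3, 7}\<close>. The vertex 6 of the only missing 3-face \<open>{2, 3, 4, 6}\<close> lies
  outside the disc, so this missing face is destroyed, and the link has no missing triangle that
  would create a new one.\<close>

lemma state_9: "state 9 0 0 0 True True"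
proof -
  let ?V = "{0, 1, 2, 3, 4, 5, 6, 7} :: nat set"
  have faces: "\<sigma> \<in> sphere_8 \<longleftrightarrow> \<sigma> \<subseteq> ?V \<and> \<not> {0, 1, 5} \<subseteq> \<sigma> \<and> \<not> {0, 4, 6} \<subseteq> \<sigma> \<and>
      \<not> {1, 5, 7} \<subseteq> \<sigma> \<and> \<not> {2, 3, 7} \<subseteq> \<sigma> \<and> \<not> {2, 3, 4, 6} \<subseteq> \<sigma>" for \<sigma>
    by (simp add: sphere_8_def nonfaces_8_def)
  have pair: "{a, b} \<in> sphere_8" if "a \<in> ?V" "b \<in> ?V" for a b
  proof -
    have "card N > 2" if "N \<in> nonfaces_8" for N
      using that by (auto simp: nonfaces_8_def)
    moreover have "card {a, b} \<le> 2"
      by (simp add: card_insert_if)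
    ultimately have "\<not> N \<subseteq> {a, b}" if "N \<in> nonfaces_8" for N
      using that card_mono[of "{a, b}" N] by fastforce
    moreover have "{a, b} \<subseteq> ?V"
      using that by simp
    ultimately show ?thesis
      unfolding sphere_8_def by blast
  qed
  have "{2, 4, a} \<in> sphere_8" if "a \<in> ?V" for a
    using that unfolding faces by auto
  then have full: "full_edge ?V sphere_8 2 4"
    unfolding full_edge_def using pl_sphere_8 card_sphere_8 pair by simp
  have missing: "F = {2, 3, 4, 6}" if "F \<in> missing_faces 3 ?V sphere_8" for F
  proof -
    have F: "F \<subseteq> ?V" "card F = 4" "F \<notin> sphere_8" "\<And>G. G \<subset> F \<Longrightarrow> G \<in> sphere_8"
      using that by (auto simp: missing_faces_def)
    \<comment> \<open>A missing face contains a listed nonface and must equal it; only one listed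
      set has four elements.\<close>
    then obtain N where N: "N \<in> nonfaces_8" "N \<subseteq> F"
      by (auto simp: sphere_8_def)
    then have "N \<notin> sphere_8"
      by (auto simp: sphere_8_def)
    then have "N = F"
      using F(4) N(2) by blast
    then show ?thesis
      using N(1) F(2) by (auto simp: nonfaces_8_def)
  qed
  have le1: "link_edge sphere_8 2 4 0 1 3 7" and le2: "link_edge sphere_8 2 4 5 7 0 6"
    unfolding link_edge_def faces by auto
  have lm: "link_missing sphere_8 2 4 = {} \<union> {}"
  proof -
    \<comment> \<open>A listed nonface inside \<open>{2, 4} \<union> T\<close> must meet
      \<open>{2, 4}\<close>, since \<open>T\<close> is a face. Its remaining two vertices are then 0
      and 6, 3 and 7, or 3 and 6, and none of these pairs is adjacent in the link.\<close>
    have False if T: "T \<in> sphere_8" "2 \<notin> T" "4 \<notin> T"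
      "\<And>a b. a \<in> T \<Longrightarrow> b \<in> T \<Longrightarrow> {2, 4, a, b} \<in> sphere_8" "{2, 4} \<union> T \<notin> sphere_8" for T
      using T(1-3,5) T(4)[of 0 6] T(4)[of 3 7] T(4)[of 3 6] unfolding faces by auto
    then show ?thesis
      unfolding link_missing_def by blast
  qed
  have "{F \<in> missing_faces 3 ?V sphere_8. \<not> {2, 4} \<subseteq> F} = {}"
    using missing by fastforce
  then have 0: "card {F \<in> missing_faces 3 ?V sphere_8. \<not> {2, 4} \<subseteq> F} = 0"
    by (simp only: card.empty)
  have unkept: "\<not> F \<subseteq> {2, 4, 0, 1, 3, 7}" if "F \<in> missing_faces 3 ?V sphere_8" for F
    unfolding missing[OF that] by simp
  have "state (8 + 1) (0 + 0) 0 0 True True"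
    by (rule state_cut_general[OF full _ 0 unkept le1 le2 _ _ _ lm]) (auto simp: faces)
  then show ?thesis by simp
qed

section \<open>Reaching every admissible number of missing 3-faces\<close>

text \<open>The k-th stack adds k missing 3-faces wherever it is made, which gives a triangular
  number. The stacks are made first at one edge, then, after a swap, at the other.\<close>

lemma state_climb:
  "state (6 + c + b) (Suc (c + b) choose 2) c b (c > 0) (b > 0)"
proof -
  have step: "state (6 + (c + k + b)) (Suc (c + k + b) choose 2) (c + k) b (oc \<or> k > 0) ob"
    if "state (6 + (c + b)) (Suc (c + b) choose 2) c b oc ob" for c b k oc ob
  proof (induction k)
    case (Suc k)
    show ?case
      using state_stack[OF Suc.IH] by (simp add: numeral_2_eq_2 ac_simps)
  qed (use that in simp)
  have "state (6 + (0 + c + 0)) (Suc (0 + c + 0) choose 2) (0 + c) 0 (False \<or> c > 0) False"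
    by (rule step) (use state_start in \<open>simp add: numeral_2_eq_2\<close>)
  then have "state (6 + (0 + c)) (Suc (0 + c) choose 2) 0 c False (c > 0)"
    using state_swap by simp
  from step[OF this, of b] show ?thesis
    using state_swap by (simp add: ac_simps)
qed

text \<open>Once the link has no missing triangles, cuts add vertices but no missing
  3-faces.\<close>

lemma state_tail: "state n m 0 0 True ob \<Longrightarrow> state (n + k) m 0 0 True ob"
proof (induction k)
  case (Suc k)
  then show ?case using state_cut[of "n + k" m 0 0 ob] by simp
qed simp

text \<open>With all missing triangles at the second edge, cutting that edge costs nothing and
  clears the link, after which the remaining vertices are free.\<close>

lemma state_settle:
  assumes "state n m 0 b True (b > 0)"
  shows "\<exists>c b oc ob. state (n + k) m c b oc ob"
proof (cases "b > 0 \<and> k > 0")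
  case True
  then have "state n m b 0 True True"
    using state_swap[OF assms] by simp
  from state_tail[OF state_cut[OF this], of "k - 1"] have "state (n + k) m 0 0 True True"
    using True by simp
  then show ?thesis
    by blast
next
  case False
  then consider "b = 0" | "k = 0" by auto
  then show ?thesis
  proof cases
    case 1
    then show ?thesis
      using state_tail[of n m _ k] assms by blast
  next
    case 2
    then show ?thesis using assms by auto
  qed
qed

lemma state_exists:
  assumes n: "n \<ge> 9" and m: "m \<le> (n - 5) choose 2" "m + 1 \<noteq> (n - 5) choose 2"
  shows "\<exists>c b oc ob. state n m c b oc ob"
proof (cases "m = 0")
  case True
  have "state (9 + (n - 9)) 0 0 0 True True"
    by (rule state_tail[OF state_9])
  then show ?thesis
    using True n by auto
next
  case False
  define N where "N = n - 6"
  define T where "T = (\<lambda>a. Suc a choose 2)"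
  have N: "n = N + 6" "(n - 5) choose 2 = T N"
  proof -
    show "n = N + 6"
      using n by (simp add: N_def)
    then have "n - 5 = Suc N"
      by simp
    then show "(n - 5) choose 2 = T N"
      by (simp add: T_def)
  qed
  have T0: "T 0 = 0" and T_Suc: "T (Suc a) = T a + Suc a" for a
    by (simp_all add: T_def numeral_2_eq_2)
  have T_mono: "T a \<le> T b" if "a \<le> b" for a b
    using that by (induction rule: dec_induct) (auto simp: T_Suc)
  have "a \<le> T a" for a
    by (induction a) (auto simp: T_Suc)
  then have bound: "a \<le> m" if "T a \<le> m" for a
    using that le_trans by blast
  \<comment> \<open>\<open>T a\<close> is the largest triangular number not above \<open>m\<close>,
    which leaves an excess \<open>r\<close> of at most \<open>a\<close>.\<close>
  define a where "a = (GREATEST a. T a \<le> m)"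
  have a: "T a \<le> m"
    unfolding a_def by (rule GreatestI_nat[of "\<lambda>a. T a \<le> m" 0 m]) (simp add: T0, rule bound)
  have "\<not> T (Suc a) \<le> m"
  proof
    assume "T (Suc a) \<le> m"
    then have "Suc a \<le> a"
      unfolding a_def by (rule Greatest_le_nat[of "\<lambda>a. T a \<le> m"]) (rule bound)
    then show False
      by simp
  qed
  then obtain r where r: "m = T a + r" "r \<le> a"
    using a by (auto simp: T_Suc dest: le_Suc_ex)
  have "a > 0"
    using False r T0 by (cases a) auto
  have "a \<le> N"
  proof (rule ccontr)
    assume "\<not> a \<le> N"
    then have "T (Suc N) \<le> m"
      using T_mono[of "Suc N" a] a by simp
    then show False
      using m(1) N(2) T_Suc[of N] by simp
  qed
  have climb: "state (6 + c + b) (T (c + b)) c b (c > 0) (b > 0)" for c b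
    using state_climb by (simp add: T_def)
  have settle: ?thesis if "state n' m 0 b True (b > 0)" "n' \<le> n" for n' b
    using state_settle[OF that(1), of "n - n'"] that(2) by simp
  \<comment> \<open>\<open>N\<close> is the number of moves available from the 6-vertex start. If
    all of them are stacks, \<open>m\<close> is the maximum \<open>T N\<close>.\<close>
  consider "a = N" | "a < N" "r < a" | "a < N" "r = a"
    using \<open>a \<le> N\<close> r(2) by linarith
  then show ?thesis
  proof cases
    case 1
    then have "m = T N"
      using r m N by simp
    then show ?thesis
      using climb[of N 0] N by (auto simp: add.commute)
  next
    case 2
    \<comment> \<open>With \<open>r\<close> stacks at the second edge and at least one at the first,
      one cut of the first edge adds exactly \<open>r\<close>.\<close>
    have "state (6 + (a - r) + r) (T (a - r + r)) (a - r) r True (r > 0)"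
      using climb[of "a - r" r] 2 by simp
    from state_cut[OF this] show ?thesis
      using 2 r N by (intro settle[of "7 + a" r]) simp_all
  next
    case 3
    \<comment> \<open>An excess of \<open>a\<close> takes two further moves instead of one. There is
      room for them unless \<open>Suc a = N\<close>, which is the case of the excluded value
      \<open>T N - 1\<close>.\<close>
    have "m + 1 = T (Suc a)"
      using 3 r by (simp add: T_Suc)
    then have "Suc a \<noteq> N"
      using m(2) N(2) by auto
    then have "8 + a \<le> n"
      using 3 N by simp
    show ?thesis
    proof (cases "even a")
      case True
      then obtain h where "a = 2 * h"
        by (rule evenE)
      then have h: "a = h + h" "h > 0"
        using \<open>a > 0\<close> by auto
      \<comment> \<open>With \<open>h\<close> stacks at each edge, two successive cuts of the first
        edge add \<open>h\<close> each.\<close>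
      have "state (6 + h + h) (T (h + h)) h h True (h > 0)"
        using climb[of h h] h by simp
      from state_cut[OF state_cut[OF this]] show ?thesis
        using h 3 r \<open>8 + a \<le> n\<close> by (intro settle[of "8 + a" h]) (simp_all add: ac_simps)
    next
      case False
      then obtain h where "a = 2 * h + 1"
        by (rule oddE)
      then have h: "a = h + h + 1"
        by simp
      \<comment> \<open>The cut of the first edge adds \<open>h\<close>; a further stack at the
        second edge then adds \<open>h + 1\<close>, for a total of \<open>a\<close>.\<close>
      have "state (6 + (h + 1) + h) (T (h + 1 + h)) (h + 1) h True (h > 0)"
        using climb[of "h + 1" h] by simp
      from state_swap[OF state_stack[OF state_swap[OF state_cut[OF this]]]] show ?thesis
        using h 3 r \<open>8 + a \<le> n\<close> by (intro settle[of "8 + a" "h + 1"]) (simp_all add: ac_simps)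
    qed
  qed
qed

theorem theorem6p3:
  fixes n :: nat and m :: int
  assumes "n \<ge> 9"
    and "0 \<le> m" and "m \<le> int ((n - 5) choose 2)"
    and "m \<noteq> int ((n - 5) choose 2) - 1"
  shows "\<exists>(V :: nat set) \<Delta>.
           pl_sphere 4 V \<Delta> \<and> neighborly_sphere 4 V \<Delta> \<and> card V = n \<and>
           int (num_missing_faces 3 V \<Delta>) = m"
proof -
  have "nat m \<le> (n - 5) choose 2" "nat m + 1 \<noteq> (n - 5) choose 2"
    using assms by auto
  then obtain c b oc ob where "state n (nat m) c b oc ob"
    using state_exists[OF assms(1)] by blast
  then show ?thesis
  proof (rule stateE)
    fix V :: "nat set" and \<Delta> u t
    assume *: "full_edge V \<Delta> u t" "card V = n" "num_missing_faces 3 V \<Delta> = nat m"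
    \<comment> \<open>For a 4-sphere the neighborliness index is \<open>(4 + 1) div 2 = 2\<close>,
      so only pairs have to be checked.\<close>
    have "F \<in> \<Delta>" if "F \<subseteq> V" "card F = 2" for F
      using that *(1) unfolding full_edge_def card_2_iff by blast
    then have "neighborly_sphere 4 V \<Delta>"
      by (simp add: neighborly_sphere_def i_neighborly_def)
    then show ?thesis
      using * assms(2) unfolding full_edge_def by (metis int_nat_eq)
  qed
qed

end
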